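(* Let $B_r$, $r\in\mathbb N_0$, be independent Gumbel-distributed random variables with distribution functions \[\mathbb P\{B_r<x\}=\exp\Bigl(-\frac{\mathrm e^{-x}}{r!}\Bigr),\quad x\in\mathbb R.\] Then \[\biggl(\frac{T_r^{(n)}}n-\ln n-r\ln\ln n,\ r\in\mathbb N_0\biggr)\xrightarrow{d}(B_r,r\in\mathbb N_0)\quad\text{in }\mathbb R^{\infty}\text{ as }n\to\infty.\]
   Context: Extended coupon collector's problem. For each $n\in\mathbb N$, coupons arrive one by one at times $1,2,3,\ldots$; the types of the coupons are independent and uniformly distributed on $\{1,\ldots,n\}$. For $i\in\{1,\ldots,n\}$ and $r\in\mathbb N_0=\mathbb N\cup\{0\}$, let $Y_{i,r}^{(n)}$ be the arrival time of the $(r+1)$-th coupon of type $i$. Let $T_r^{(n)}=\max_{1\le i\le n}Y_{i,r}^{(n)}$, the time when the collector labelled $r$ completes his collection, i.e. the first time at which at least $r+1$ coupons of each type have arrived. $\xrightarrow{d}$ denotes convergence in distribution, and $\mathbb R^\infty$ is the space of real sequences with the product topology. *)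

theory Defs
  imports "HOL-Probability.Probability"
begin

text \<open>
  Convergence in distribution of random elements of a topological space; the
  \<open>n\<close>-th random element may live on its own probability space. Measurability is
  part of the notion, since the Bochner integral of a non-measurable function is \<open>0\<close>.
  The space of real sequences with the product topology is the type \<open>nat \<Rightarrow> real\<close>.
\<close>

definition converges_in_distribution ::
  "(nat \<Rightarrow> 'a measure) \<Rightarrow> (nat \<Rightarrow> 'a \<Rightarrow> 'c) \<Rightarrow> 'b measure \<Rightarrow> ('b \<Rightarrow> 'c::topological_space) \<Rightarrow> bool"
  where
  "converges_in_distribution M Z N W \<longleftrightarrow>
     (\<forall>\<^sub>F n in sequentially. Z n \<in> borel_measurable (M n)) \<and>
     W \<in> borel_measurable N \<and>
     (\<forall>f :: 'c \<Rightarrow> real. continuous_on UNIV f \<and> bounded (range f) \<longrightarrow>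
        (\<lambda>n. \<integral>\<omega>. f (Z n \<omega>) \<partial>M n) \<longlonglongrightarrow> (\<integral>\<omega>. f (W \<omega>) \<partial>N))"

text \<open>
  Here \<open>c k\<close> is the type of the coupon arriving at time \<open>k \<ge> 1\<close> (\<open>c 0\<close> is ignored).
  If fewer than \<open>r + 1\<close> coupons of type \<open>i\<close> ever arrive, which happens with
  probability \<open>0\<close>, then \<open>arrival_time c i r\<close> is the fixed but unspecified number \<open>LEAST k. False\<close>.
\<close>

definition arrival_time :: "(nat \<Rightarrow> nat) \<Rightarrow> nat \<Rightarrow> nat \<Rightarrow> nat" where
  "arrival_time c i r = (LEAST k. card {j \<in> {1..k}. c j = i} = r + 1)"

definition completion_time :: "nat \<Rightarrow> (nat \<Rightarrow> nat) \<Rightarrow> nat \<Rightarrow> nat" where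
  "completion_time n c r = Max ((\<lambda>i. arrival_time c i r) ` {1..n})"

end

theory Submission
  imports Defs "HOL-Real_Asymp.Real_Asymp"
begin

text \<open>
  Why the theorem holds.  Fix finitely many labels \<open>I \<subseteq> {..m}\<close> and reals \<open>x\<^sub>r\<close>, and put
  \<open>t\<^sub>r = n (ln n + r ln ln n + x\<^sub>r)\<close>.  Because \<open>ln ln n\<close> tends to infinity, these times are
  eventually increasing in \<open>r\<close>, and they cut the coupon sequence into independent blocks.  The
  event that collector \<open>r\<close> is done by time \<open>t\<^sub>r\<close>, for every \<open>r \<in> I\<close>, says that each type has more
  than \<open>r\<close> coupons in the first \<open>r + 1\<close> blocks together.  The types compete for the places in a
  block and so are dependent.  This is cured by making the block lengths independent Poisson
  variables: then the counts of the single types in the single blocks are all independent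
  Poisson variables (\<open>bind_poisson_multinomial_pmf\<close>), and the probability of the event becomes
  an exact \<open>n\<close>-th power \<open>(1 - q)\<^sup>n\<close> (\<open>poissonized_prob\<close>).
  
  Here \<open>q\<close> is the probability that one given type is late for some label.  At time \<open>t\<^sub>r\<close> the
  count of that type is Poisson with mean \<open>ln n + r ln ln n + x\<^sub>r\<close>, and the chance that it is at
  most \<open>r\<close> is asymptotic to \<open>exp (- x\<^sub>r) / (r! n)\<close> (\<open>poisson_tail_critical\<close>).  The lateness
  events for different labels are asymptotically disjoint: each block after the first adds
  a Poisson number of coupons with mean about \<open>ln ln n\<close>, so a type late for \<open>r\<close> catches up
  with high probability before the next deadline.  Hence \<open>n q\<close> tends to
  \<open>\<Lambda> = (\<Sum>r\<in>I. exp (- x\<^sub>r) / r!)\<close> (\<open>miss_prob_tendsto\<close>), and \<open>(1 - q)\<^sup>n\<close> tends to \<open>exp (- \<Lambda>)\<close>,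
  which is the product of the Gumbel distribution functions.  The independence of the limits
  comes from this additivity.
  
  Randomizing the block lengths does no harm.  The probability of the event increases with
  the block lengths, the limit is continuous in \<open>x\<close>, and by Chebyshev's inequality the Poisson
  lengths deviate with high probability by less than any fixed multiple of \<open>n\<close>, since their
  variances are only of order \<open>n ln n\<close>.  So the true probability is sandwiched between Poissonized ones with slightly
  shifted \<open>x\<close> (\<open>poissonized_sandwich\<close>, \<open>prob_collected_tendsto\<close>).
  
  Finally, convergence of the joint distribution functions of all finite subfamilies implies
  convergence in distribution in the sequence space (\<open>converges_in_distribution_if_orthants\<close>):
  an open set is a countable union of half-open boxes restricting finitely many coordinates,
  and probabilities of finite unions of boxes are determined by distribution functions through
  finitely many additions and subtractions.
\<close>

section \<open>Weak convergence of random sequences\<close>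

lemma card_nat_less_real_bounds:
  fixes a :: real
  assumes "0 \<le> a" "a \<le> real k"
  shows "real (card {j \<in> {1..k}. real j < a}) \<le> a"
    and "a - 1 \<le> real (card {j \<in> {1..k}. real j < a})"
proof -
  have eq: "{j \<in> {1..k}. real j < a} = {1..nat (\<lceil>a\<rceil> - 1)}"
    using assms by (auto simp: le_nat_iff less_ceiling_iff) linarith+
  show "real (card {j \<in> {1..k}. real j < a}) \<le> a"
    unfolding eq using assms by simp linarith
  show "a - 1 \<le> real (card {j \<in> {1..k}. real j < a})"
    unfolding eq using assms by simp linarith
qed

text \<open>
  A discrete layer-cake formula: the sum of the indicators of \<open>j / k < g\<close> over \<open>j = 1, \<dots>, k\<close>
  differs from \<open>k g\<close> by at most one, so expectations are controlled by finitely many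
  probabilities of superlevel sets.
\<close>

lemma (in prob_space) layer_sum_bounds:
  fixes g :: "'a \<Rightarrow> real"
  assumes [measurable]: "g \<in> borel_measurable M"
    and g: "\<And>\<omega>. \<omega> \<in> space M \<Longrightarrow> 0 \<le> g \<omega> \<and> g \<omega> \<le> 1" and k: "k > 0"
  shows "(\<Sum>j=1..k. \<P>(\<omega> in M. real j / real k < g \<omega>)) / real k \<le> expectation g"
    and "expectation g - 1 / real k \<le> (\<Sum>j=1..k. \<P>(\<omega> in M. real j / real k < g \<omega>)) / real k"
proof -
  define h where "h = (\<lambda>\<omega>. \<Sum>j=1..k. indicator {\<omega> \<in> space M. real j / real k < g \<omega>} \<omega> :: real)"
  have h_card: "h \<omega> = real (card {j \<in> {1..k}. real j < real k * g \<omega>})" if "\<omega> \<in> space M" for \<omega>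
    using that k by (simp add: h_def indicator_def sum.If_cases Int_def field_simps)
  have int_h: "integrable M h"
    unfolding h_def by (intro Bochner_Integration.integrable_sum integrable_real_indicator) (auto simp: emeasure_eq_measure)
  have int_g: "integrable M g"
    by (intro integrable_const_bound[where B = 1]) (use g in auto)
  have exp_h: "expectation h = (\<Sum>j=1..k. \<P>(\<omega> in M. real j / real k < g \<omega>))"
    unfolding h_def by (subst Bochner_Integration.integral_sum) (auto simp: emeasure_eq_measure intro!: integrable_real_indicator)
  have bnd: "h \<omega> \<le> real k * g \<omega>" "real k * g \<omega> - 1 \<le> h \<omega>" if "\<omega> \<in> space M" for \<omega>
    using card_nat_less_real_bounds[of "real k * g \<omega>" k] g[OF that] that k
    by (auto simp: h_card mult_left_le)
  have "expectation h \<le> expectation (\<lambda>\<omega>. real k * g \<omega>)"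
    by (intro integral_mono int_h integrable_mult_right int_g bnd)
  thus "(\<Sum>j=1..k. \<P>(\<omega> in M. real j / real k < g \<omega>)) / real k \<le> expectation g"
    using k by (simp add: exp_h field_simps)
  have "expectation (\<lambda>\<omega>. real k * g \<omega> - 1) \<le> expectation h"
    by (intro integral_mono int_h Bochner_Integration.integrable_diff integrable_mult_right int_g bnd) auto
  hence "real k * expectation g - 1 \<le> expectation h"
    using int_g by (simp add: prob_space)
  hence "(real k * expectation g - 1) / real k \<le> expectation h / real k"
    using k by (intro divide_right_mono) auto
  thus "expectation g - 1 / real k \<le> (\<Sum>j=1..k. \<P>(\<omega> in M. real j / real k < g \<omega>)) / real k"
    unfolding exp_h using k by (simp add: diff_divide_distrib)
qed

text \<open>
  The portmanteau implication from open sets to bounded continuous functions.  The superlevel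
  sets of a continuous \<open>g\<close> with values in \<open>[0, 1]\<close> are open, hence the layers bound its
  expectations from below in the limit; applied to the rescalings of \<open>f\<close> and of \<open>- f\<close>, this
  bounds the expectations of \<open>f\<close> from both sides.
\<close>

lemma converges_in_distribution_if_open_sets:
  fixes M :: "nat \<Rightarrow> 'a measure" and Z :: "nat \<Rightarrow> 'a \<Rightarrow> 'c::topological_space"
    and N :: "'b measure" and W :: "'b \<Rightarrow> 'c"
  assumes M: "\<forall>\<^sub>F n in sequentially. prob_space (M n)" and N: "prob_space N"
    and Z: "\<forall>\<^sub>F n in sequentially. Z n \<in> borel_measurable (M n)" and W: "W \<in> borel_measurable N"
    and lower: "\<And>G \<epsilon>. open G \<Longrightarrow> 0 < \<epsilon> \<Longrightarrow>
       \<forall>\<^sub>F n in sequentially. \<P>(\<omega> in N. W \<omega> \<in> G) - \<epsilon> < \<P>(\<omega> in M n. Z n \<omega> \<in> G)"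
  shows "converges_in_distribution M Z N W"
proof -
  have below: "\<forall>\<^sub>F n in sequentially. (\<integral>\<omega>. g (W \<omega>) \<partial>N) - \<epsilon> < (\<integral>\<omega>. g (Z n \<omega>) \<partial>M n)"
    if g: "continuous_on UNIV g" "\<And>z. 0 \<le> g z \<and> g z \<le> 1" and "0 < \<epsilon>" for g :: "'c \<Rightarrow> real" and \<epsilon>
  proof -
    have [measurable]: "g \<in> borel_measurable borel"
      using g(1) by (rule borel_measurable_continuous_onI)
    obtain k :: nat where k: "k > 0" "1 / real k < \<epsilon> / 2"
      using \<open>0 < \<epsilon>\<close> by (metis half_gt_zero nat_approx_posE zero_less_Suc)
    have "\<forall>\<^sub>F n in sequentially. \<forall>j\<in>{1..k}.
        \<P>(\<omega> in N. W \<omega> \<in> {z. real j / real k < g z}) - \<epsilon> / 2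
          < \<P>(\<omega> in M n. Z n \<omega> \<in> {z. real j / real k < g z})"
      using \<open>0 < \<epsilon>\<close> g(1) by (intro eventually_ball_finite ballI lower open_Collect_less) auto
    with M Z show ?thesis
    proof eventually_elim
      case (elim n)
      have "(\<integral>\<omega>. g (W \<omega>) \<partial>N) - 1 / real k \<le> (\<Sum>j=1..k. \<P>(\<omega> in N. real j / real k < g (W \<omega>))) / real k"
        by (intro prob_space.layer_sum_bounds[OF N] k) (use W g in auto)
      also have "\<dots> \<le> (\<Sum>j=1..k. \<P>(\<omega> in M n. real j / real k < g (Z n \<omega>)) + \<epsilon> / 2) / real k"
        using elim(3) by (intro divide_right_mono sum_mono) (auto intro: less_imp_le simp: diff_less_eq)
      also have "\<dots> = (\<Sum>j=1..k. \<P>(\<omega> in M n. real j / real k < g (Z n \<omega>))) / real k + \<epsilon> / 2"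
        using k by (simp add: sum.distrib add_divide_distrib)
      also have "\<dots> \<le> (\<integral>\<omega>. g (Z n \<omega>) \<partial>M n) + \<epsilon> / 2"
        by (intro add_right_mono prob_space.layer_sum_bounds[OF elim(1)] k) (use elim(2) g in auto)
      finally show ?case using k(2) by simp
    qed
  qed
  have "(\<lambda>n. \<integral>\<omega>. f (Z n \<omega>) \<partial>M n) \<longlonglongrightarrow> (\<integral>\<omega>. f (W \<omega>) \<partial>N)"
    if f: "continuous_on UNIV f" "bounded (range f)" for f :: "'c \<Rightarrow> real"
  proof -
    obtain c where c: "c > 0" "\<And>z. \<bar>f z\<bar> \<le> c"
      using f(2) by (auto simp: bounded_pos)
    have [measurable]: "f \<in> borel_measurable borel"
      using f(1) by (rule borel_measurable_continuous_onI)
    \<comment> \<open>The affine images of f and -f with values in [0, 1], for s = 1 and s = -1.\<close>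
    define g where "g s z = (1 + s * f z / c) / 2" for s z
    have g: "continuous_on UNIV (g s)" "0 \<le> g s z \<and> g s z \<le> 1" if "s = 1 \<or> s = -1" for s z
    proof -
      show "continuous_on UNIV (g s)"
        unfolding g_def using f(1) c(1) by (intro continuous_intros) auto
      have "-1 \<le> f z / c" "f z / c \<le> 1"
        using c(1) c(2)[of z] by (auto simp: field_simps)
      thus "0 \<le> g s z \<and> g s z \<le> 1"
        using that by (auto simp: g_def)
    qed
    have int: "(\<integral>\<omega>. g s (V \<omega>) \<partial>L) = (1 + s * (\<integral>\<omega>. f (V \<omega>) \<partial>L) / c) / 2"
      if "prob_space L" "V \<in> borel_measurable L" for L :: "'d measure" and V s
    proof -
      interpret prob_space L by fact
      have [measurable]: "V \<in> borel_measurable L" by fact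
      have "integrable L (\<lambda>\<omega>. f (V \<omega>))"
        by (intro integrable_const_bound[where B = c]) (use c in auto)
      thus ?thesis by (simp add: g_def prob_space)
    qed
    show ?thesis
    proof (rule tendstoI)
      fix e :: real assume "e > 0"
      hence e: "0 < e / (2 * c)" using c by simp
      have "\<forall>\<^sub>F n in sequentially. (\<integral>\<omega>. g 1 (W \<omega>) \<partial>N) - e / (2 * c) < (\<integral>\<omega>. g 1 (Z n \<omega>) \<partial>M n)"
           "\<forall>\<^sub>F n in sequentially. (\<integral>\<omega>. g (-1) (W \<omega>) \<partial>N) - e / (2 * c) < (\<integral>\<omega>. g (-1) (Z n \<omega>) \<partial>M n)"
        using below g e by auto
      with M Z show "\<forall>\<^sub>F n in sequentially. dist (\<integral>\<omega>. f (Z n \<omega>) \<partial>M n) (\<integral>\<omega>. f (W \<omega>) \<partial>N) < e"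
      proof eventually_elim
        case (elim n)
        have scale: "s * a - e < s * b" if "(1 + s * a / c) / 2 - e / (2 * c) < (1 + s * b / c) / 2" for s a b
        proof -
          have "(c + (s * a - e)) / (2 * c) < (c + s * b) / (2 * c)"
            using that c(1) by (simp add: add_divide_distrib diff_divide_distrib)
          thus ?thesis using c(1) by (simp add: divide_less_cancel)
        qed
        show ?case
          using elim(3,4)[unfolded int[OF N W] int[OF elim(1,2)], THEN scale]
          by (simp add: dist_real_def abs_less_iff)
      qed
    qed
  qed
  with Z W show ?thesis unfolding converges_in_distribution_def by blast
qed

text \<open>
  Removing the sets of \<open>Q\<close> one at a time costs only one further intersection, which stays in
  the \<open>\<pi>\<close>-system \<open>P\<close>; thus limits of probabilities pass from \<open>P\<close> to the algebra it generates
  by finitely many subtractions.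
\<close>

lemma converges_on_diff_Union:
  fixes M :: "nat \<Rightarrow> 'a measure" and Z :: "nat \<Rightarrow> 'a \<Rightarrow> 'c"
    and N :: "'b measure" and W :: "'b \<Rightarrow> 'c"
  assumes M: "\<forall>\<^sub>F n in sequentially. prob_space (M n)" and N: "prob_space N"
    and meas: "\<And>A. A \<in> P \<Longrightarrow> \<forall>\<^sub>F n in sequentially. {\<omega> \<in> space (M n). Z n \<omega> \<in> A} \<in> sets (M n)"
      "\<And>A. A \<in> P \<Longrightarrow> {\<omega> \<in> space N. W \<omega> \<in> A} \<in> sets N"
    and Int: "\<And>A B. A \<in> P \<Longrightarrow> B \<in> P \<Longrightarrow> A \<inter> B \<in> P"
    and conv: "\<And>A. A \<in> P \<Longrightarrow> (\<lambda>n. \<P>(\<omega> in M n. Z n \<omega> \<in> A)) \<longlonglongrightarrow> \<P>(\<omega> in N. W \<omega> \<in> A)"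
    and "finite Q" "Q \<subseteq> P" "A \<in> P"
  shows "(\<lambda>n. \<P>(\<omega> in M n. Z n \<omega> \<in> A - \<Union>Q)) \<longlonglongrightarrow> \<P>(\<omega> in N. W \<omega> \<in> A - \<Union>Q)"
  using assms(7,8,9)
proof (induction Q arbitrary: A rule: finite_induct)
  case empty
  thus ?case by (simp add: conv)
next
  case (insert B Q)
  have split: "\<P>(\<omega> in L. V \<omega> \<in> A - \<Union>(insert B Q))
      = \<P>(\<omega> in L. V \<omega> \<in> A - \<Union>Q) - \<P>(\<omega> in L. V \<omega> \<in> (A \<inter> B) - \<Union>Q)"
    if "prob_space L" and m: "\<forall>C\<in>insert A (insert B Q). {\<omega> \<in> space L. V \<omega> \<in> C} \<in> sets L"
    for L :: "'d measure" and V
  proof -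
    interpret prob_space L by fact
    have U: "{\<omega> \<in> space L. V \<omega> \<in> C - \<Union>Q} \<in> sets L"
      if "{\<omega> \<in> space L. V \<omega> \<in> C} \<in> sets L" for C
    proof -
      have "{\<omega> \<in> space L. V \<omega> \<in> C - \<Union>Q} = {\<omega> \<in> space L. V \<omega> \<in> C} - (\<Union>D\<in>Q. {\<omega> \<in> space L. V \<omega> \<in> D})"
        by auto
      thus ?thesis using that m insert.hyps by (auto intro!: sets.Diff sets.finite_UN)
    qed
    have AB: "{\<omega> \<in> space L. V \<omega> \<in> A \<inter> B} \<in> sets L"
    proof -
      have "{\<omega> \<in> space L. V \<omega> \<in> A \<inter> B} = {\<omega> \<in> space L. V \<omega> \<in> A} \<inter> {\<omega> \<in> space L. V \<omega> \<in> B}" by auto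
      thus ?thesis using m by auto
    qed
    have "prob ({\<omega> \<in> space L. V \<omega> \<in> A - \<Union>Q} - {\<omega> \<in> space L. V \<omega> \<in> (A \<inter> B) - \<Union>Q})
        = \<P>(\<omega> in L. V \<omega> \<in> A - \<Union>Q) - \<P>(\<omega> in L. V \<omega> \<in> (A \<inter> B) - \<Union>Q)"
      using m U AB by (intro finite_measure_Diff) auto
    moreover have "{\<omega> \<in> space L. V \<omega> \<in> A - \<Union>Q} - {\<omega> \<in> space L. V \<omega> \<in> (A \<inter> B) - \<Union>Q}
        = {\<omega> \<in> space L. V \<omega> \<in> A - \<Union>(insert B Q)}" by auto
    ultimately show ?thesis by simp
  qed
  have "\<forall>\<^sub>F n in sequentially. \<forall>C\<in>insert A (insert B Q). {\<omega> \<in> space (M n). Z n \<omega> \<in> C} \<in> sets (M n)"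
    using insert by (intro eventually_ball_finite ballI meas) auto
  with M have ev: "\<forall>\<^sub>F n in sequentially. \<P>(\<omega> in M n. Z n \<omega> \<in> A - \<Union>(insert B Q))
      = \<P>(\<omega> in M n. Z n \<omega> \<in> A - \<Union>Q) - \<P>(\<omega> in M n. Z n \<omega> \<in> (A \<inter> B) - \<Union>Q)"
    by eventually_elim (rule split)
  have lim: "\<P>(\<omega> in N. W \<omega> \<in> A - \<Union>(insert B Q))
      = \<P>(\<omega> in N. W \<omega> \<in> A - \<Union>Q) - \<P>(\<omega> in N. W \<omega> \<in> (A \<inter> B) - \<Union>Q)"
    using insert meas by (intro split N) auto
  have "(\<lambda>n. \<P>(\<omega> in M n. Z n \<omega> \<in> A - \<Union>Q) - \<P>(\<omega> in M n. Z n \<omega> \<in> (A \<inter> B) - \<Union>Q))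
     \<longlonglongrightarrow> \<P>(\<omega> in N. W \<omega> \<in> A - \<Union>Q) - \<P>(\<omega> in N. W \<omega> \<in> (A \<inter> B) - \<Union>Q)"
    using insert Int by (intro tendsto_diff insert.IH) auto
  thus ?case unfolding lim using ev by (subst tendsto_cong) auto
qed

text \<open>
  The inner box is open, so such boxes form open covers to which the Lindelof property applies;
  the half-open outer box belongs to a \<open>\<pi>\<close>-system.
\<close>

lemma open_sequences_contains_box:
  fixes G :: "(nat \<Rightarrow> real) set"
  assumes "open G" "z \<in> G"
  obtains I a b where "finite I" "\<forall>r\<in>I. a r < z r \<and> z r < b r"
    "{y. \<forall>r\<in>I. a r < y r \<and> y r \<le> b r} \<subseteq> G"
proof -
  have "openin (product_topology (\<lambda>_. euclidean) UNIV) G"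
    using \<open>open G\<close> by (simp add: open_fun_def)
  from product_topology_open_contains_basis[OF this \<open>z \<in> G\<close>] obtain U where
    U: "z \<in> Pi\<^sub>E UNIV U" "\<And>r. open (U r)" "finite {r. U r \<noteq> UNIV}" "Pi\<^sub>E UNIV U \<subseteq> G"
    by auto
  have "\<forall>r. \<exists>e>0. ball (z r) e \<subseteq> U r"
    using U(1,2) by (auto simp: open_contains_ball PiE_def Pi_def)
  then obtain e where e: "\<And>r. e r > 0" "\<And>r. ball (z r) (e r) \<subseteq> U r" by metis
  show ?thesis
  proof
    show "\<forall>r\<in>{r. U r \<noteq> UNIV}. z r - e r / 2 < z r \<and> z r < z r + e r / 2"
      using e(1) by simp
    show "{y. \<forall>r\<in>{r. U r \<noteq> UNIV}. z r - e r / 2 < y r \<and> y r \<le> z r + e r / 2} \<subseteq> G"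
    proof (rule subset_trans[OF _ U(4)], safe)
      fix y r assume y: "\<forall>r\<in>{r. U r \<noteq> UNIV}. z r - e r / 2 < y r \<and> y r \<le> z r + e r / 2"
      show "y r \<in> U r"
      proof (cases "U r = UNIV")
        case False
        hence "z r - e r / 2 < y r \<and> y r \<le> z r + e r / 2" using y by auto
        hence "\<bar>z r - y r\<bar> < e r" using e(1)[of r] by linarith
        thus ?thesis using e(2)[of r] by (auto simp: dist_real_def)
      qed simp
    qed simp
  qed (use U in auto)
qed

text \<open>
  Convergence of the distribution functions of finite subfamilies at every point gives, by
  subtraction, convergence on half-open boxes and on their finite unions.  An open set is
  exhausted in probability by such a union, which yields the lower bound needed for open sets.
\<close>

theorem converges_in_distribution_if_orthants:
  fixes M :: "nat \<Rightarrow> 'a measure" and Z :: "nat \<Rightarrow> 'a \<Rightarrow> nat \<Rightarrow> real"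
    and N :: "'b measure" and W :: "'b \<Rightarrow> nat \<Rightarrow> real"
  assumes M: "\<forall>\<^sub>F n in sequentially. prob_space (M n)" and N: "prob_space N"
    and Z: "\<forall>\<^sub>F n in sequentially. Z n \<in> borel_measurable (M n)" and W: "W \<in> borel_measurable N"
    and conv: "\<And>I x. finite I \<Longrightarrow> (\<lambda>n. \<P>(\<omega> in M n. \<forall>r\<in>I. Z n \<omega> r \<le> x r))
       \<longlonglongrightarrow> \<P>(\<omega> in N. \<forall>r\<in>I. W \<omega> r \<le> x r)"
  shows "converges_in_distribution M Z N W"
proof (rule converges_in_distribution_if_open_sets[OF M N Z W])
  define orth where "orth I x = {z :: nat \<Rightarrow> real. \<forall>r\<in>I. z r \<le> x r}" for I and x :: "nat \<Rightarrow> real"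
  define box where "box I a b = {z :: nat \<Rightarrow> real. \<forall>r\<in>I. a r < z r \<and> z r \<le> b r}"
    for I and a b :: "nat \<Rightarrow> real"
  define orths where "orths = {orth I x | I x. finite I}"
  define boxes where "boxes = {box I a b | I a b. finite I}"
  have sets: "A \<in> sets borel" if "A \<in> orths \<union> boxes" for A
    using that unfolding orths_def boxes_def orth_def box_def
    by (auto intro!: borel_measurable_pred_less simp: pred_def[symmetric])
  have meas: "\<forall>\<^sub>F n in sequentially. {\<omega> \<in> space (M n). Z n \<omega> \<in> A} \<in> sets (M n)"
       "{\<omega> \<in> space N. W \<omega> \<in> A} \<in> sets N" if "A \<in> sets borel" for A
    using Z W that by (auto elim!: eventually_mono)

  have orths_Int: "A \<inter> B \<in> orths" if AB: "A \<in> orths" "B \<in> orths" for A B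
  proof -
    obtain I x J y where *: "A = orth I x" "B = orth J y" "finite I" "finite J"
      using AB by (auto simp: orths_def)
    have "A \<inter> B = orth (I \<union> J) (\<lambda>r. if r \<in> I then if r \<in> J then min (x r) (y r) else x r else y r)"
      unfolding * orth_def by auto
    thus ?thesis using * unfolding orths_def by blast
  qed
  have boxes_Int: "A \<inter> B \<in> boxes" if AB: "A \<in> boxes" "B \<in> boxes" for A B
  proof -
    obtain I a b J a' b' where *: "A = box I a b" "B = box J a' b'" "finite I" "finite J"
      using AB by (auto simp: boxes_def)
    have "A \<inter> B = box (I \<union> J) (\<lambda>r. if r \<in> I then if r \<in> J then max (a r) (a' r) else a r else a' r)
       (\<lambda>r. if r \<in> I then if r \<in> J then min (b r) (b' r) else b r else b' r)"
      unfolding * box_def by auto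
    thus ?thesis using * unfolding boxes_def by blast
  qed

  have conv_orths: "(\<lambda>n. \<P>(\<omega> in M n. Z n \<omega> \<in> A)) \<longlonglongrightarrow> \<P>(\<omega> in N. W \<omega> \<in> A)"
    if "A \<in> orths" for A
    using that conv by (auto simp: orths_def orth_def)
  have conv_boxes: "(\<lambda>n. \<P>(\<omega> in M n. Z n \<omega> \<in> A)) \<longlonglongrightarrow> \<P>(\<omega> in N. W \<omega> \<in> A)"
    if A: "A \<in> boxes" for A
  proof -
    obtain I a b where I: "A = box I a b" "finite I"
      using A by (auto simp: boxes_def)
    \<comment> \<open>A half-open box is an orthant minus finitely many orthants.\<close>
    have "A = orth I b - \<Union>((\<lambda>r. orth {r} a) ` I)"
      unfolding I box_def orth_def by force
    moreover have "(\<lambda>n. \<P>(\<omega> in M n. Z n \<omega> \<in> orth I b - \<Union>((\<lambda>r. orth {r} a) ` I)))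
        \<longlonglongrightarrow> \<P>(\<omega> in N. W \<omega> \<in> orth I b - \<Union>((\<lambda>r. orth {r} a) ` I))"
      using I(2)
      by (intro converges_on_diff_Union[where P = orths] M N meas conv_orths orths_Int sets)
         (auto simp: orths_def)
    ultimately show ?thesis by simp
  qed
  have UNIV_boxes: "UNIV \<in> boxes"
    by (force simp: boxes_def box_def)

  fix G :: "(nat \<Rightarrow> real) set" and \<epsilon> :: real
  assume G: "open G" and "0 < \<epsilon>"
  show "\<forall>\<^sub>F n in sequentially. \<P>(\<omega> in N. W \<omega> \<in> G) - \<epsilon> < \<P>(\<omega> in M n. Z n \<omega> \<in> G)"
  proof (cases "G = {}")
    case True
    thus ?thesis using \<open>0 < \<epsilon>\<close> by simp
  next
    case False
    define inner where "inner = (\<lambda>(I, a, b). {z :: nat \<Rightarrow> real. \<forall>r\<in>I. a r < z r \<and> z r < b r})"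
    define idx where "idx = {(I, a, b). finite I \<and> box I a b \<subseteq> G}"
    have "open S" if "S \<in> inner ` idx" for S
    proof -
      obtain I a b where S: "S = (\<Inter>r\<in>I. {z. a r < z r \<and> z r < b r})" "finite I"
        using \<open>S \<in> inner ` idx\<close> by (auto simp: inner_def idx_def)
      show ?thesis unfolding S(1)
        by (intro open_INT S ballI open_Collect_conj open_Collect_less continuous_intros
              continuous_on_product_coordinates)
    qed
    then obtain \<F> where \<F>: "\<F> \<subseteq> inner ` idx" "countable \<F>" "\<Union>\<F> = \<Union>(inner ` idx)"
      using Lindelof by metis
    obtain K where K: "K \<subseteq> idx" "countable K" "\<F> = inner ` K"
      using \<F> by (metis countable_subset_image)
    define C where "C = (\<lambda>(I, a, b). box I a b) ` K"
    have C: "countable C" "C \<subseteq> boxes"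
      using K by (auto simp: C_def boxes_def idx_def)
    have "\<Union>C = G"
    proof
      show "\<Union>C \<subseteq> G" using K by (auto simp: C_def idx_def)
      show "G \<subseteq> \<Union>C"
      proof
        fix z assume "z \<in> G"
        obtain I a b where "finite I" "\<forall>r\<in>I. a r < z r \<and> z r < b r"
            "{y. \<forall>r\<in>I. a r < y r \<and> y r \<le> b r} \<subseteq> G"
          by (rule open_sequences_contains_box[OF G \<open>z \<in> G\<close>])
        hence "z \<in> \<Union>(inner ` idx)"
          by (intro UnionI[of "inner (I, a, b)"] imageI) (auto simp: idx_def box_def inner_def)
        then obtain I a b where "(I, a, b) \<in> K" "z \<in> inner (I, a, b)"
          unfolding \<F>(3)[symmetric] K(3) by auto
        moreover from this have "box I a b \<in> C"
          unfolding C_def by (intro image_eqI[of _ _ "(I, a, b)"]) auto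
        moreover have "inner (I, a, b) \<subseteq> box I a b"
          by (auto simp: inner_def box_def less_imp_le)
        ultimately show "z \<in> \<Union>C" by blast
      qed
    qed
    with False have "C \<noteq> {}" by auto
    define D where "D k = (\<Union>i\<le>k. from_nat_into C i)" for k
    have D: "finite (from_nat_into C ` {..k})" "from_nat_into C ` {..k} \<subseteq> boxes" for k
      using C(2) from_nat_into[OF \<open>C \<noteq> {}\<close>] by auto
    have UN_D: "(\<Union>k. D k) = G"
      unfolding D_def \<open>\<Union>C = G\<close>[symmetric]
      using range_from_nat_into[OF \<open>C \<noteq> {}\<close> C(1)] by blast
    have D_sets: "D k \<in> sets borel" for k
      using D(2) sets by (auto simp: D_def)
    interpret N: prob_space N by (rule N)
    have "(\<lambda>k. \<P>(\<omega> in N. W \<omega> \<in> D k)) \<longlonglongrightarrow> N.prob (\<Union>k. {\<omega> \<in> space N. W \<omega> \<in> D k})"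
    proof (intro N.finite_Lim_measure_incseq)
      show "range (\<lambda>k. {\<omega> \<in> space N. W \<omega> \<in> D k}) \<subseteq> N.events"
        using meas(2)[OF D_sets] by auto
      show "incseq (\<lambda>k. {\<omega> \<in> space N. W \<omega> \<in> D k})"
        by (auto simp: incseq_def D_def intro: order.trans)
    qed
    also have "(\<Union>k. {\<omega> \<in> space N. W \<omega> \<in> D k}) = {\<omega> \<in> space N. W \<omega> \<in> G}"
      using UN_D by auto
    finally have "(\<lambda>k. \<P>(\<omega> in N. W \<omega> \<in> D k)) \<longlonglongrightarrow> \<P>(\<omega> in N. W \<omega> \<in> G)" .
    \<comment> \<open>Finitely many boxes already carry all but \<open>\<epsilon>\<close> of the probability of \<open>G\<close>.\<close>
    from order_tendstoD(1)[OF this, of "\<P>(\<omega> in N. W \<omega> \<in> G) - \<epsilon>"] \<open>0 < \<epsilon>\<close>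
    obtain k where k: "\<P>(\<omega> in N. W \<omega> \<in> G) - \<epsilon> < \<P>(\<omega> in N. W \<omega> \<in> D k)"
      by (auto simp: eventually_sequentially)
    have compl: "\<P>(\<omega> in L. V \<omega> \<in> D k) = 1 - \<P>(\<omega> in L. V \<omega> \<in> UNIV - \<Union>(from_nat_into C ` {..k}))"
      if "prob_space L" "{\<omega> \<in> space L. V \<omega> \<in> D k} \<in> sets L" for L :: "'d measure" and V
      using prob_space.prob_neg[OF that] by (simp add: D_def)
    have "(\<lambda>n. 1 - \<P>(\<omega> in M n. Z n \<omega> \<in> UNIV - \<Union>(from_nat_into C ` {..k})))
        \<longlonglongrightarrow> 1 - \<P>(\<omega> in N. W \<omega> \<in> UNIV - \<Union>(from_nat_into C ` {..k}))"
      using D UNIV_boxes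
      by (intro tendsto_intros converges_on_diff_Union[where P = boxes] M N meas conv_boxes boxes_Int sets)
         auto
    moreover have "\<forall>\<^sub>F n in sequentially. 1 - \<P>(\<omega> in M n. Z n \<omega> \<in> UNIV - \<Union>(from_nat_into C ` {..k}))
        = \<P>(\<omega> in M n. Z n \<omega> \<in> D k)"
      using M meas(1)[OF D_sets[of k]] by eventually_elim (simp add: compl)
    ultimately have "(\<lambda>n. \<P>(\<omega> in M n. Z n \<omega> \<in> D k)) \<longlonglongrightarrow> \<P>(\<omega> in N. W \<omega> \<in> D k)"
      using N meas(2)[OF D_sets[of k]] by (simp add: compl tendsto_cong)
    hence "\<forall>\<^sub>F n in sequentially. \<P>(\<omega> in N. W \<omega> \<in> G) - \<epsilon> < \<P>(\<omega> in M n. Z n \<omega> \<in> D k)"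
      using k by (rule order_tendstoD(1))
    thus ?thesis
      using M meas(1)[OF borel_open[OF G]]
    proof eventually_elim
      case (elim n)
      interpret prob_space "M n" by fact
      have "\<P>(\<omega> in M n. Z n \<omega> \<in> D k) \<le> \<P>(\<omega> in M n. Z n \<omega> \<in> G)"
        using elim UN_D by (intro finite_measure_mono) auto
      thus ?case using elim by linarith
    qed
  qed
qed

section \<open>Counts of uniform draws and Poissonization\<close>

definition type_counts :: "nat set \<Rightarrow> (nat \<Rightarrow> nat) \<Rightarrow> nat \<Rightarrow> nat" where
  "type_counts S w i = card {k \<in> S. w k = i}"

lemma type_counts_insert:
  assumes "finite S" "k \<notin> S"
  shows "type_counts (insert k S) (w(k := i)) = (type_counts S w)(i := Suc (type_counts S w i))"
proof
  fix j
  have "{l \<in> insert k S. (w(k := i)) l = j} = (if j = i then insert k {l \<in> S. w l = j} else {l \<in> S. w l = j})"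
    using assms by auto
  thus "type_counts (insert k S) (w(k := i)) j = ((type_counts S w)(i := Suc (type_counts S w i))) j"
    using assms by (auto simp: type_counts_def)
qed

text \<open>
  Positions outside \<open>S\<close> carry the value \<open>0\<close>, which is not a coupon type.
\<close>

definition draws :: "nat \<Rightarrow> nat set \<Rightarrow> (nat \<Rightarrow> nat) pmf" where
  "draws n S = Pi_pmf S 0 (\<lambda>_. pmf_of_set {1..n})"

lemma map_type_counts_insert:
  assumes "finite S" "k \<notin> S" "n \<ge> 1"
  shows "map_pmf (type_counts (insert k S)) (draws n (insert k S)) =
    do {i \<leftarrow> pmf_of_set {1..n}; map_pmf (\<lambda>v. v(i := Suc (v i))) (map_pmf (type_counts S) (draws n S))}"
  unfolding draws_def using assms
  by (subst Pi_pmf_insert')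
     (simp_all add: map_pmf_def bind_assoc_pmf bind_return_pmf type_counts_insert)

text \<open>
  The multinomial distribution.  With one more draw, \<open>v\<close> arises from the vectors in which one
  coordinate \<open>v i\<close> is lowered by one; their multinomial coefficients are proportional to
  \<open>v i\<close>, and these add up to the number of draws.
\<close>

lemma pmf_type_counts_draws:
  assumes "finite S" "n \<ge> 1"
  shows "pmf (map_pmf (type_counts S) (draws n S)) v =
    (if (\<forall>i. i \<notin> {1..n} \<longrightarrow> v i = 0) \<and> (\<Sum>i=1..n. v i) = card S
     then fact (card S) / (\<Prod>i=1..n. fact (v i)) / real n ^ card S else 0)"
  using assms(1)
proof (induction S arbitrary: v rule: finite_induct)
  case empty
  have "type_counts {} w = (\<lambda>_. 0)" for w by (auto simp: type_counts_def)
  moreover have "(\<forall>i. i \<notin> {1..n} \<longrightarrow> v i = 0) \<and> (\<Sum>i=1..n. v i) = 0 \<longleftrightarrow> v = (\<lambda>_. 0)"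
    by (auto simp: fun_eq_iff)
  ultimately show ?case by (auto simp: draws_def indicator_def)
next
  case (insert k S)
  let ?q = "map_pmf (type_counts S) (draws n S)"
  define D where "D v \<longleftrightarrow> (\<forall>i. i \<notin> {1..n} \<longrightarrow> v i = 0)" for v :: "nat \<Rightarrow> nat"
  have IH: "pmf ?q v = (if D v \<and> (\<Sum>i=1..n. v i) = card S
      then fact (card S) / (\<Prod>i=1..n. fact (v i)) / real n ^ card S else 0)" for v
    unfolding D_def by (rule insert.IH)
  have step: "pmf (map_pmf (\<lambda>v. v(i := Suc (v i))) ?q) v =
      (if D v \<and> (\<Sum>i=1..n. v i) = Suc (card S)
       then real (v i) * (fact (card S) / (\<Prod>i=1..n. fact (v i)) / real n ^ card S) else 0)"
    if i: "i \<in> {1..n}" for i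
  proof (cases "v i")
    case 0
    hence "v \<noteq> u(i := Suc (u i))" for u by auto
    hence "pmf (map_pmf (\<lambda>v. v(i := Suc (v i))) ?q) v = 0"
      by (intro pmf_map_outside) auto
    thus ?thesis using 0 by simp
  next
    case (Suc c)
    have inj: "inj (\<lambda>v::nat \<Rightarrow> nat. v(i := Suc (v i)))"
      by (auto simp: inj_def fun_eq_iff split: if_splits)
    have v: "v = (v(i := c))(i := Suc ((v(i := c)) i))"
      using Suc by (auto simp: fun_eq_iff)
    have "pmf (map_pmf (\<lambda>v. v(i := Suc (v i))) ?q) v = pmf ?q (v(i := c))"
      by (subst v) (rule pmf_map_inj'[OF inj])
    also have "(\<Sum>j=1..n. (v(i := c)) j) + 1 = (\<Sum>j=1..n. v j)"
      using i Suc by (simp add: sum.remove)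
    moreover have "D (v(i := c)) \<longleftrightarrow> D v" using i by (auto simp: D_def)
    moreover have "(\<Prod>j=1..n. fact (v j) :: real) = real (v i) * (\<Prod>j=1..n. fact ((v(i := c)) j))"
      using i Suc by (simp add: prod.remove)
    ultimately show ?thesis using Suc
      by (simp add: IH del: fun_upd_apply)
  qed
  have "pmf (map_pmf (type_counts (insert k S)) (draws n (insert k S))) v =
      (\<Sum>i=1..n. pmf (map_pmf (\<lambda>v. v(i := Suc (v i))) ?q) v) / real n"
    using insert.hyps assms by (subst map_type_counts_insert) (auto simp: pmf_bind_pmf_of_set)
  also have "(\<Sum>i=1..n. pmf (map_pmf (\<lambda>v. v(i := Suc (v i))) ?q) v) =
      (if D v \<and> (\<Sum>i=1..n. v i) = Suc (card S)
       then real (\<Sum>i=1..n. v i) * (fact (card S) / (\<Prod>i=1..n. fact (v i)) / real n ^ card S) else 0)"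
  proof (cases "D v \<and> (\<Sum>i=1..n. v i) = Suc (card S)")
    case True
    have "(\<Sum>i=1..n. pmf (map_pmf (\<lambda>v. v(i := Suc (v i))) ?q) v) =
        (\<Sum>i=1..n. real (v i) * (fact (card S) / (\<Prod>i=1..n. fact (v i)) / real n ^ card S))"
      by (intro sum.cong refl) (subst step, assumption, subst if_P[OF True], rule refl)
    thus ?thesis
      by (subst if_P[OF True]) (simp only: of_nat_sum sum_distrib_right)
  next
    case False
    have "(\<Sum>i=1..n. pmf (map_pmf (\<lambda>v. v(i := Suc (v i))) ?q) v) = 0"
      using False by (intro sum.neutral ballI) (simp only: step if_False)
    thus ?thesis by (simp only: False if_False)
  qed
  finally show ?case
    unfolding D_def[symmetric] using insert.hyps assms by simp
qed

corollary map_type_counts_draws_cong: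
  assumes "finite S" "finite T" "card S = card T" "n \<ge> 1"
  shows "map_pmf (type_counts S) (draws n S) = map_pmf (type_counts T) (draws n T)"
  by (rule pmf_eqI)
     (simp only: pmf_type_counts_draws[OF assms(1,4)] pmf_type_counts_draws[OF assms(2,4)] assms(3))

definition multinomial_pmf :: "nat \<Rightarrow> nat \<Rightarrow> (nat \<Rightarrow> nat) pmf" where
  "multinomial_pmf n d = map_pmf (type_counts {1..d}) (draws n {1..d})"

text \<open>
  Poisson thinning: when the number of draws is Poisson, the factorial in the multinomial
  coefficient cancels the one in the Poisson weight, and what remains factorizes over the types.
\<close>

lemma bind_poisson_multinomial_pmf:
  assumes n: "n \<ge> 1" and \<mu>: "\<mu> > 0"
  shows "poisson_pmf \<mu> \<bind> multinomial_pmf n = Pi_pmf {1..n} 0 (\<lambda>_. poisson_pmf (\<mu> / real n))"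
proof (rule pmf_eqI)
  fix v :: "nat \<Rightarrow> nat"
  show "pmf (poisson_pmf \<mu> \<bind> multinomial_pmf n) v = pmf (Pi_pmf {1..n} 0 (\<lambda>_. poisson_pmf (\<mu> / real n))) v"
  proof (cases "\<forall>i. i \<notin> {1..n} \<longrightarrow> v i = 0")
    case False
    have "pmf (multinomial_pmf n d) v = 0" for d
      unfolding multinomial_pmf_def using False n by (subst pmf_type_counts_draws) auto
    hence "pmf (poisson_pmf \<mu> \<bind> multinomial_pmf n) v = 0"
      by (simp add: pmf_bind)
    moreover have "pmf (Pi_pmf {1..n} 0 (\<lambda>_. poisson_pmf (\<mu> / real n))) v = 0"
      using False by (intro pmf_Pi_outside) auto
    ultimately show ?thesis by simp
  next
    case True
    define s where "s = (\<Sum>i=1..n. v i)"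
    \<comment> \<open>Only the number of draws equal to the total of \<open>v\<close> contributes.\<close>
    have "pmf (poisson_pmf \<mu> \<bind> multinomial_pmf n) v = (\<Sum>d\<in>{s}. pmf (multinomial_pmf n d) v * pmf (poisson_pmf \<mu>) d)"
      unfolding pmf_bind
      by (intro integral_measure_pmf_real)
         (use n in \<open>auto simp: multinomial_pmf_def pmf_type_counts_draws s_def split: if_splits\<close>)
    also have "\<dots> = exp (-\<mu>) * (\<mu> / real n) ^ s / (\<Prod>i=1..n. fact (v i))"
      using True n \<mu> by (simp add: multinomial_pmf_def pmf_type_counts_draws s_def power_divide mult.commute)
    also have "\<dots> = (\<Prod>i=1..n. (\<mu> / real n) ^ v i / fact (v i) * exp (- (\<mu> / real n)))"
    proof -
      have "exp (- (\<mu> / real n)) ^ n = exp (-\<mu>)"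
        using n by (subst exp_of_nat_mult[symmetric]) simp
      thus ?thesis by (simp add: prod.distrib prod_dividef power_sum s_def)
    qed
    also have "\<dots> = pmf (Pi_pmf {1..n} 0 (\<lambda>_. poisson_pmf (\<mu> / real n))) v"
      using True n \<mu> by (subst pmf_Pi') auto
    finally show ?thesis .
  qed
qed

lemma Pi_pmf_transpose:
  assumes "finite A" "finite B"
  shows "Pi_pmf A (\<lambda>_. d) (\<lambda>a. Pi_pmf B d (p a)) =
    map_pmf (\<lambda>F a b. F b a) (Pi_pmf B (\<lambda>_. d) (\<lambda>b. Pi_pmf A d (\<lambda>a. p a b)))"
proof (rule pmf_eqI)
  fix F :: "'a \<Rightarrow> 'b \<Rightarrow> 'c"
  have expand: "pmf (Pi_pmf A' (\<lambda>_. d) (\<lambda>a. Pi_pmf B' d (q a))) G =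
      (if \<forall>a b. a \<notin> A' \<or> b \<notin> B' \<longrightarrow> G a b = d then \<Prod>a\<in>A'. \<Prod>b\<in>B'. pmf (q a b) (G a b) else 0)"
    if "finite A'" "finite B'" for A' :: "'x set" and B' :: "'y set" and q G
  proof (cases "\<forall>a b. a \<notin> A' \<or> b \<notin> B' \<longrightarrow> G a b = d")
    case True
    thus ?thesis using that by (auto simp: pmf_Pi fun_eq_iff intro!: prod.cong)
  next
    case False
    then obtain a b where ab: "a \<notin> A' \<or> b \<notin> B'" "G a b \<noteq> d" by auto
    have "pmf (Pi_pmf A' (\<lambda>_. d) (\<lambda>a. Pi_pmf B' d (q a))) G = 0"
    proof (cases "a \<in> A'")
      case True
      hence "pmf (Pi_pmf B' d (q a)) (G a) = 0"
        using ab that by (intro pmf_Pi_outside) auto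
      hence "(\<Prod>x\<in>A'. pmf (Pi_pmf B' d (q x)) (G x)) = 0"
        using True that by (intro prod_zero) auto
      thus ?thesis by (subst pmf_Pi[OF that(1)]) (simp only: if_cancel)
    next
      case notin: False
      thus ?thesis using ab that by (intro pmf_Pi_outside) (auto simp: fun_eq_iff intro!: exI[of _ a])
    qed
    thus ?thesis by (subst if_not_P[OF False])
  qed
  have inj: "inj (\<lambda>F (a::'a) (b::'b). F b a :: 'c)"
    by (auto simp: inj_def fun_eq_iff)
  have "pmf (map_pmf (\<lambda>F a b. F b a) (Pi_pmf B (\<lambda>_. d) (\<lambda>b. Pi_pmf A d (\<lambda>a. p a b)))) F
      = pmf (Pi_pmf B (\<lambda>_. d) (\<lambda>b. Pi_pmf A d (\<lambda>a. p a b))) (\<lambda>b a. F a b)"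
    using pmf_map_inj'[OF inj, of _ "\<lambda>b a. F a b"] by simp
  also have "\<dots> = pmf (Pi_pmf A (\<lambda>_. d) (\<lambda>a. Pi_pmf B d (p a))) F"
    unfolding expand[OF assms] expand[OF assms(2,1)]
    by (subst prod.swap) auto
  finally show "pmf (Pi_pmf A (\<lambda>_. d) (\<lambda>a. Pi_pmf B d (p a))) F =
      pmf (map_pmf (\<lambda>F a b. F b a) (Pi_pmf B (\<lambda>_. d) (\<lambda>b. Pi_pmf A d (\<lambda>a. p a b)))) F" ..
qed

text \<open>
  With independent Poisson block lengths the counts form an array of independent Poisson
  variables.  Read type by type instead of block by block, it consists of \<open>n\<close> independent copies
  of one column, so an event required of every type has an \<open>n\<close>-th power as its probability.
\<close>

lemma poissonized_prob:
  assumes n: "n \<ge> 1" and J: "finite J" and \<rho>: "\<And>j. j \<in> J \<Longrightarrow> \<rho> j > 0"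
  shows "measure_pmf.expectation (Pi_pmf J 0 (\<lambda>j. poisson_pmf (real n * \<rho> j)))
      (\<lambda>D. measure_pmf.prob (Pi_pmf J (\<lambda>_. 0) (\<lambda>j. multinomial_pmf n (D j))) {C. \<forall>i\<in>{1..n}. P (\<lambda>j. C j i)})
    = measure_pmf.prob (Pi_pmf J 0 (\<lambda>j. poisson_pmf (\<rho> j))) {c. P c} ^ n"
proof -
  have "Pi_pmf J 0 (\<lambda>j. poisson_pmf (real n * \<rho> j)) \<bind> (\<lambda>D. Pi_pmf J (\<lambda>_. 0) (\<lambda>j. multinomial_pmf n (D j)))
     = Pi_pmf J (\<lambda>_. 0) (\<lambda>j. poisson_pmf (real n * \<rho> j) \<bind> multinomial_pmf n)"
    by (rule Pi_pmf_bind[OF J, symmetric])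
  also have "\<dots> = Pi_pmf J (\<lambda>_. 0) (\<lambda>j. Pi_pmf {1..n} 0 (\<lambda>_. poisson_pmf (\<rho> j)))"
    using n \<rho> by (intro Pi_pmf_cong) (auto simp: bind_poisson_multinomial_pmf)
  also have "\<dots> = map_pmf (\<lambda>F j i. F i j) (Pi_pmf {1..n} (\<lambda>_. 0) (\<lambda>_. Pi_pmf J 0 (\<lambda>j. poisson_pmf (\<rho> j))))"
    by (rule Pi_pmf_transpose) (auto simp: J)
  finally have eq: "Pi_pmf J 0 (\<lambda>j. poisson_pmf (real n * \<rho> j)) \<bind> (\<lambda>D. Pi_pmf J (\<lambda>_. 0) (\<lambda>j. multinomial_pmf n (D j))) = \<dots>" .
  have "measure_pmf.expectation (Pi_pmf J 0 (\<lambda>j. poisson_pmf (real n * \<rho> j)))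
      (\<lambda>D. measure_pmf.prob (Pi_pmf J (\<lambda>_. 0) (\<lambda>j. multinomial_pmf n (D j))) {C. \<forall>i\<in>{1..n}. P (\<lambda>j. C j i)})
     = measure_pmf.prob (Pi_pmf J 0 (\<lambda>j. poisson_pmf (real n * \<rho> j)) \<bind>
         (\<lambda>D. Pi_pmf J (\<lambda>_. 0) (\<lambda>j. multinomial_pmf n (D j)))) {C. \<forall>i\<in>{1..n}. P (\<lambda>j. C j i)}"
    by (simp add: measure_pmf_bind measure_pmf.measure_bind[where N = "count_space UNIV"] measure_pmf_in_subprob_algebra)
  also have "\<dots> = measure_pmf.prob (Pi_pmf {1..n} (\<lambda>_. 0) (\<lambda>_. Pi_pmf J 0 (\<lambda>j. poisson_pmf (\<rho> j))))
      (Pi {1..n} (\<lambda>_. {c. P c}))"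
    unfolding eq by (simp add: vimage_def Pi_def Ball_def)
  also have "\<dots> = measure_pmf.prob (Pi_pmf J 0 (\<lambda>j. poisson_pmf (\<rho> j))) {c. P c} ^ n"
    by (subst measure_Pi_pmf_Pi) auto
  finally show ?thesis .
qed

section \<open>From the coupon sequence to independent blocks\<close>

text \<open>
  The joint distribution of finitely many independent discrete variables is a product, on the
  given probability space and for the product PMF alike; hence events determined by these
  variables have the same probability on both sides.
\<close>

lemma (in prob_space) prob_indep_vars_eq_Pi_pmf:
  fixes X :: "'i \<Rightarrow> 'a \<Rightarrow> 'b :: countable"
  assumes indep: "indep_vars (\<lambda>_. count_space UNIV) X S" and S: "finite S"
    and distr: "\<And>k. k \<in> S \<Longrightarrow> distr M (count_space UNIV) (X k) = measure_pmf (p k)"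
    and Q: "\<And>w w'. (\<And>k. k \<in> S \<Longrightarrow> w k = w' k) \<Longrightarrow> Q w \<longleftrightarrow> Q w'"
  shows "\<P>(\<omega> in M. Q (\<lambda>k. X k \<omega>)) = measure_pmf.prob (Pi_pmf S z p) {w. Q w}"
proof (cases "S = {}")
  case True
  hence "Q w \<longleftrightarrow> Q w'" for w w' by (intro Q) auto
  hence "Q = (\<lambda>_. True) \<or> Q = (\<lambda>_. False)" by (metis (full_types) ext)
  thus ?thesis by (auto simp: prob_space)
next
  case False
  let ?P = "Pi\<^sub>M S (\<lambda>_. count_space UNIV)"
  define A where "A = {w \<in> S \<rightarrow>\<^sub>E UNIV. Q w}"
  have P: "?P = count_space (S \<rightarrow>\<^sub>E (UNIV :: 'b set))"
    using S by (intro count_space_PiM_finite) auto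
  have A: "A \<in> sets ?P" unfolding P by (auto simp: A_def)
  have [measurable]: "X k \<in> measurable M (count_space UNIV)" if "k \<in> S" for k
    using indep that by (auto simp: indep_vars_def)
  have m: "(\<lambda>\<omega>. \<lambda>k\<in>S. X k \<omega>) \<in> measurable M ?P"
    by (intro measurable_restrict) auto
  have m': "(\<lambda>w. \<lambda>k\<in>S. w k) \<in> measurable (measure_pmf (Pi_pmf S z p)) ?P"
    by (intro measurable_restrict) auto
  have "distr M ?P (\<lambda>\<omega>. \<lambda>k\<in>S. X k \<omega>) = Pi\<^sub>M S (\<lambda>k. distr M (count_space UNIV) (X k))"
    using indep by (subst indep_vars_iff_distr_eq_PiM'[symmetric]) (use False in auto)
  also have "\<dots> = Pi\<^sub>M S (\<lambda>k. distr (measure_pmf (Pi_pmf S z p)) (count_space UNIV) (\<lambda>w. w k))"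
  proof (intro PiM_cong refl)
    fix k assume k: "k \<in> S"
    have "distr (measure_pmf (Pi_pmf S z p)) (count_space UNIV) (\<lambda>w. w k)
        = measure_pmf (map_pmf (\<lambda>w. w k) (Pi_pmf S z p))"
      by (simp add: map_pmf_rep_eq)
    thus "distr M (count_space UNIV) (X k) = distr (measure_pmf (Pi_pmf S z p)) (count_space UNIV) (\<lambda>w. w k)"
      using k S by (simp add: distr Pi_pmf_component)
  qed
  also have "\<dots> = distr (measure_pmf (Pi_pmf S z p)) ?P (\<lambda>w. \<lambda>k\<in>S. w k)"
    using indep_vars_Pi_pmf[OF S, of z p]
    by (subst (asm) prob_space.indep_vars_iff_distr_eq_PiM')
       (use False in \<open>auto simp: measure_pmf.prob_space_axioms\<close>)
  finally have "measure (distr M ?P (\<lambda>\<omega>. \<lambda>k\<in>S. X k \<omega>)) A =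
      measure (distr (measure_pmf (Pi_pmf S z p)) ?P (\<lambda>w. \<lambda>k\<in>S. w k)) A" by simp
  hence "prob ((\<lambda>\<omega>. \<lambda>k\<in>S. X k \<omega>) -` A \<inter> space M) =
      measure_pmf.prob (Pi_pmf S z p) ((\<lambda>w. \<lambda>k\<in>S. w k) -` A)"
    by (simp add: measure_distr[OF m A] measure_distr[OF m' A])
  moreover have "(\<lambda>\<omega>. \<lambda>k\<in>S. X k \<omega>) -` A \<inter> space M = {\<omega> \<in> space M. Q (\<lambda>k. X k \<omega>)}"
    using Q[of "\<lambda>k\<in>S. X k \<omega>" "\<lambda>k. X k \<omega>" for \<omega>] by (auto simp: A_def)
  moreover have "(\<lambda>w. \<lambda>k\<in>S. w k) -` A = {w. Q w}"
    using Q[of "\<lambda>k\<in>S. w k" w for w] by (auto simp: A_def)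
  ultimately show ?thesis by simp
qed

lemma type_counts_cong: "(\<And>k. k \<in> S \<Longrightarrow> w k = w' k) \<Longrightarrow> type_counts S w = type_counts S w'"
  by (auto simp: type_counts_def fun_eq_iff intro!: arg_cong[where f = card])

lemma map_type_counts_blocks:
  assumes "finite J" "\<And>j. j \<in> J \<Longrightarrow> finite (S j)" "disjoint_family_on S J"
  shows "map_pmf (\<lambda>w j. if j \<in> J then type_counts (S j) w else (\<lambda>_. 0)) (draws n (\<Union>j\<in>J. S j)) =
    Pi_pmf J (\<lambda>_. 0) (\<lambda>j. map_pmf (type_counts (S j)) (draws n (S j)))"
  using assms
proof (induction J rule: finite_induct)
  case empty
  thus ?case by simp
next
  case (insert j J)
  let ?T = "\<Union>i\<in>J. S i"
  have disj: "S j \<inter> ?T = {}" and disj': "disjoint_family_on S J"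
    using insert.prems insert.hyps by (auto simp: disjoint_family_on_def)
  define G where "G w = (\<lambda>i. if i \<in> J then type_counts (S i) w else (\<lambda>_. 0))" for w
  have glue: "(\<lambda>i. if i \<in> insert j J then type_counts (S i) (\<lambda>x. if x \<in> S j then f x else g x) else (\<lambda>_. 0))
      = (G g)(j := type_counts (S j) f)" for f g
  proof -
    have "type_counts (S j) (\<lambda>x. if x \<in> S j then f x else g x) = type_counts (S j) f"
      by (rule type_counts_cong) auto
    moreover have "type_counts (S i) (\<lambda>x. if x \<in> S j then f x else g x) = type_counts (S i) g" if "i \<in> J" for i
      by (rule type_counts_cong) (use disj that in auto)
    ultimately show ?thesis by (auto simp: G_def fun_eq_iff)
  qed
  have "draws n (\<Union>i\<in>insert j J. S i) =
      map_pmf (\<lambda>(f, g) x. if x \<in> S j then f x else g x) (pair_pmf (draws n (S j)) (draws n ?T))"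
    unfolding draws_def UN_insert using insert.prems insert.hyps disj by (intro Pi_pmf_union) auto
  hence "map_pmf (\<lambda>w i. if i \<in> insert j J then type_counts (S i) w else (\<lambda>_. 0)) (draws n (\<Union>i\<in>insert j J. S i))
      = map_pmf (\<lambda>(f, g). (G g)(j := type_counts (S j) f)) (pair_pmf (draws n (S j)) (draws n ?T))"
    by (simp only: map_pmf_comp case_prod_unfold glue)
  also have "\<dots> = map_pmf (\<lambda>(y, h). h(j := y))
      (map_pmf (\<lambda>(f, g). (type_counts (S j) f, G g)) (pair_pmf (draws n (S j)) (draws n ?T)))"
    by (simp only: map_pmf_comp case_prod_unfold fst_conv snd_conv)
  also have "\<dots> = map_pmf (\<lambda>(y, h). h(j := y)) (pair_pmf (map_pmf (type_counts (S j)) (draws n (S j)))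
      (Pi_pmf J (\<lambda>_. 0) (\<lambda>i. map_pmf (type_counts (S i)) (draws n (S i)))))"
    using insert.IH insert.prems disj' by (simp add: map_pair G_def)
  also have "\<dots> = Pi_pmf (insert j J) (\<lambda>_. 0) (\<lambda>i. map_pmf (type_counts (S i)) (draws n (S i)))"
    by (rule Pi_pmf_insert[symmetric]) (use insert.hyps in auto)
  finally show ?case .
qed

text \<open>
  The consecutive blocks of lengths \<open>d 0, d 1, \<dots>\<close> use disjoint sets of draws, so their count
  vectors are independent and multinomial.  In this form the block lengths can be randomized.
\<close>

lemma (in prob_space) prob_all_types_collected:
  fixes X :: "nat \<Rightarrow> 'a \<Rightarrow> nat" and d :: "nat \<Rightarrow> nat"
  defines "t \<equiv> \<lambda>r. \<Sum>j\<le>r. d j"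
  assumes indep: "indep_vars (\<lambda>_. count_space UNIV) X {1..}"
    and distr: "\<And>k. k \<ge> 1 \<Longrightarrow> distr M (count_space UNIV) (X k) = measure_pmf (pmf_of_set {1..n})"
    and n: "n \<ge> 1" and I: "I \<subseteq> {..m}"
  shows "\<P>(\<omega> in M. \<forall>i\<in>{1..n}. \<forall>r\<in>I. r < type_counts {1..t r} (\<lambda>k. X k \<omega>) i) =
    measure_pmf.prob (Pi_pmf {..m} (\<lambda>_. 0) (\<lambda>j. multinomial_pmf n (d j)))
      {C. \<forall>i\<in>{1..n}. \<forall>r\<in>I. r < (\<Sum>j\<le>r. C j i)}"
proof -
  define S where "S j = {(\<Sum>i<j. d i)<..t j}" for j
  have mono: "t i \<le> t j" if "i \<le> j" for i j
    unfolding t_def using that by (intro sum_mono2) auto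
  have t_lt: "(\<Sum>i<j. d i) = (if j = 0 then 0 else t (j - 1))" for j
    by (cases j) (auto simp: t_def lessThan_Suc_atMost)
  have card: "card (S j) = d j" for j
    by (auto simp: S_def t_def lessThan_Suc_atMost[symmetric])
  have disj: "disjoint_family S"
  proof -
    have "S i \<inter> S j = {}" if "i < j" for i j
    proof -
      have "t i \<le> t (j - 1)" using that by (intro mono) auto
      thus ?thesis using that by (auto simp: S_def t_lt)
    qed
    thus ?thesis unfolding disjoint_family_on_def by (metis Int_commute nat_neq_iff)
  qed
  have UN: "(\<Union>j\<le>r. S j) = {1..t r}" for r
  proof (induction r)
    case 0
    thus ?case by (auto simp: S_def)
  next
    case (Suc r)
    have "(\<Union>j\<le>Suc r. S j) = {1..t r} \<union> {t r<..t (Suc r)}"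
      using Suc by (auto simp: atMost_Suc S_def t_lt)
    also have "\<dots> = {1..t (Suc r)}" using mono[of r "Suc r"] by auto
    finally show ?case .
  qed
  have counts: "type_counts {1..t r} w i = (\<Sum>j\<le>r. type_counts (S j) w i)" for r w i
  proof -
    have "{k \<in> {1..t r}. w k = i} = (\<Union>j\<le>r. {k \<in> S j. w k = i})"
      unfolding UN[symmetric] by auto
    also have "card \<dots> = (\<Sum>j\<le>r. card {k \<in> S j. w k = i})"
    proof (intro card_UN_disjoint ballI impI)
      show "{k \<in> S a. w k = i} \<inter> {k \<in> S b. w k = i} = {}" if "a \<noteq> b" for a b
        using disj that by (auto dest: disjoint_family_onD)
    qed (auto simp: S_def)
    finally show ?thesis by (simp add: type_counts_def)
  qed
  let ?good = "\<lambda>C. \<forall>i\<in>{1..n}. \<forall>r\<in>I. r < (\<Sum>j\<le>r. C j i)"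
  let ?F = "\<lambda>w j. if j \<in> {..m} then type_counts (S j) w else (\<lambda>_. 0)"
  have "\<P>(\<omega> in M. \<forall>i\<in>{1..n}. \<forall>r\<in>I. r < type_counts {1..t r} (\<lambda>k. X k \<omega>) i) =
      measure_pmf.prob (Pi_pmf {1..t m} 0 (\<lambda>_. pmf_of_set {1..n}))
        {w. \<forall>i\<in>{1..n}. \<forall>r\<in>I. r < type_counts {1..t r} w i}"
  proof (rule prob_indep_vars_eq_Pi_pmf)
    show "indep_vars (\<lambda>_. count_space UNIV) X {1..t m}"
      using indep by (rule indep_vars_subset) auto
    fix w w' :: "nat \<Rightarrow> nat" assume "\<And>k. k \<in> {1..t m} \<Longrightarrow> w k = w' k"
    hence "type_counts {1..t r} w = type_counts {1..t r} w'" if "r \<in> I" for r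
      using that I mono[of r m] by (intro type_counts_cong) auto
    thus "(\<forall>i\<in>{1..n}. \<forall>r\<in>I. r < type_counts {1..t r} w i) \<longleftrightarrow> (\<forall>i\<in>{1..n}. \<forall>r\<in>I. r < type_counts {1..t r} w' i)"
      by auto
  qed (use distr in auto)
  also have "{w. \<forall>i\<in>{1..n}. \<forall>r\<in>I. r < type_counts {1..t r} w i} = ?F -` {C. ?good C}"
  proof -
    have "type_counts {1..t r} w i = (\<Sum>j\<le>r. ?F w j i)" if "r \<in> I" for r w i
      unfolding counts using that I by (intro sum.cong) auto
    thus ?thesis by (auto simp del: One_nat_def)
  qed
  also have "measure_pmf.prob (Pi_pmf {1..t m} 0 (\<lambda>_. pmf_of_set {1..n})) (?F -` {C. ?good C}) =
      measure_pmf.prob (map_pmf ?F (draws n (\<Union>j\<in>{..m}. S j))) {C. ?good C}"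
    by (simp add: draws_def UN)
  also have "map_pmf ?F (draws n (\<Union>j\<in>{..m}. S j)) =
      Pi_pmf {..m} (\<lambda>_. 0) (\<lambda>j. map_pmf (type_counts (S j)) (draws n (S j)))"
  proof (rule map_type_counts_blocks)
    show "disjoint_family_on S {..m}"
      using disj by (rule disjoint_family_on_mono[rotated]) simp
  qed (auto simp: S_def)
  also have "\<dots> = Pi_pmf {..m} (\<lambda>_. 0) (\<lambda>j. multinomial_pmf n (d j))"
    unfolding multinomial_pmf_def using n card
    by (intro Pi_pmf_cong refl map_type_counts_draws_cong) (auto simp: S_def)
  finally show ?thesis .
qed

section \<open>Poisson distributions\<close>

text \<open>
  The variance, from \<open>(k - \<mu>)\<^sup>2 = k (k - 1) + (1 - 2 \<mu>) k + \<mu>\<^sup>2\<close> and the factorial moments, whose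
  series are index shifts of the exponential series.
\<close>

lemma nn_integral_poisson_square_deviation:
  assumes "\<mu> > 0"
  shows "(\<integral>\<^sup>+k. ennreal ((real k - \<mu>)\<^sup>2) \<partial>measure_pmf (poisson_pmf \<mu>)) = ennreal \<mu>"
proof -
  define p where "p k = \<mu> ^ k / fact k * exp (-\<mu>)" for k
  have p: "p sums 1"
  proof -
    have "(\<lambda>k. \<mu> ^ k / fact k * exp (-\<mu>)) sums (exp \<mu> * exp (-\<mu>))"
      using exp_converges[of \<mu>] by (intro sums_mult2) (simp add: field_simps)
    thus ?thesis by (simp add: p_def[abs_def] exp_minus)
  qed
  have step: "real (Suc k) * p (Suc k) = \<mu> * p k" for k
    by (simp add: p_def field_simps del: of_nat_Suc)
  have "(\<lambda>k. real (Suc k) * p (Suc k)) sums \<mu>"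
    unfolding step using sums_mult[OF p, of \<mu>] by simp
  hence p1: "(\<lambda>k. real k * p k) sums \<mu>"
    by (subst (asm) sums_Suc_iff) simp
  have "real (Suc k) * (real (Suc k) - 1) * p (Suc k) = \<mu> * (real k * p k)" for k
    using step[of k] by (simp add: mult_ac)
  hence "(\<lambda>k. real (Suc k) * (real (Suc k) - 1) * p (Suc k)) sums \<mu>\<^sup>2"
    using sums_mult[OF p1, of \<mu>] by (simp add: power2_eq_square del: of_nat_Suc)
  hence p2: "(\<lambda>k. real k * (real k - 1) * p k) sums \<mu>\<^sup>2"
    by (subst (asm) sums_Suc_iff) simp
  have "(\<lambda>k. real k * (real k - 1) * p k + (1 - 2 * \<mu>) * (real k * p k) + \<mu>\<^sup>2 * p k)
      sums (\<mu>\<^sup>2 + (1 - 2 * \<mu>) * \<mu> + \<mu>\<^sup>2 * 1)"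
    by (intro sums_add sums_mult p p1 p2)
  moreover have "(\<lambda>k. real k * (real k - 1) * p k + (1 - 2 * \<mu>) * (real k * p k) + \<mu>\<^sup>2 * p k)
      = (\<lambda>k. p k * (real k - \<mu>)\<^sup>2)"
    by (auto simp: fun_eq_iff power2_eq_square algebra_simps)
  ultimately have sums: "(\<lambda>k. p k * (real k - \<mu>)\<^sup>2) sums \<mu>"
    by (simp add: power2_eq_square algebra_simps)
  have nonneg: "p k \<ge> 0" for k using assms by (simp add: p_def)
  have "(\<integral>\<^sup>+k. ennreal ((real k - \<mu>)\<^sup>2) \<partial>measure_pmf (poisson_pmf \<mu>))
      = (\<Sum>k. ennreal (p k * (real k - \<mu>)\<^sup>2))"
  proof -
    have "ennreal (pmf (poisson_pmf \<mu>) k) * ennreal ((real k - \<mu>)\<^sup>2) = ennreal (p k * (real k - \<mu>)\<^sup>2)" for k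
      using assms nonneg[of k] by (subst ennreal_mult) (auto simp: p_def)
    thus ?thesis
      by (simp only: nn_integral_measure_pmf nn_integral_count_space_nat)
  qed
  also have "\<dots> = ennreal (\<Sum>k. p k * (real k - \<mu>)\<^sup>2)"
    using sums nonneg by (intro suminf_ennreal2) (auto simp: sums_iff)
  finally show ?thesis using sums by (simp add: sums_iff)
qed

text \<open>
  Chebyshev's inequality.
\<close>

lemma poisson_deviation:
  assumes "\<mu> > 0" "a > 0"
  shows "measure_pmf.prob (poisson_pmf \<mu>) {k. a \<le> \<bar>real k - \<mu>\<bar>} \<le> \<mu> / a\<^sup>2"
proof -
  have sq: "a \<le> \<bar>x\<bar> \<longleftrightarrow> 1 \<le> inverse (a\<^sup>2) * x\<^sup>2" for x :: real
  proof -
    have "a \<le> \<bar>x\<bar> \<longleftrightarrow> a\<^sup>2 \<le> x\<^sup>2"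
      using assms(2) by (metis abs_le_square_iff abs_of_pos)
    thus ?thesis using assms(2) by (simp add: field_simps)
  qed
  have "emeasure (measure_pmf (poisson_pmf \<mu>)) {k. a \<le> \<bar>real k - \<mu>\<bar>}
      = emeasure (measure_pmf (poisson_pmf \<mu>)) ({k \<in> UNIV. 1 \<le> ennreal (inverse (a\<^sup>2)) * ennreal ((real k - \<mu>)\<^sup>2)} \<inter> UNIV)"
    unfolding sq by (simp add: ennreal_mult[symmetric] flip: ennreal_1)
  also have "\<dots> \<le> ennreal (inverse (a\<^sup>2)) * (\<integral>\<^sup>+k. ennreal ((real k - \<mu>)\<^sup>2) * indicator UNIV k \<partial>measure_pmf (poisson_pmf \<mu>))"
    using nn_integral_Markov_inequality[of "\<lambda>k. ennreal ((real k - \<mu>)\<^sup>2)" UNIV "measure_pmf (poisson_pmf \<mu>)" "ennreal (inverse (a\<^sup>2))"]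
    by simp
  also have "\<dots> = ennreal (\<mu> / a\<^sup>2)"
    using assms by (simp add: nn_integral_poisson_square_deviation ennreal_mult[symmetric] field_simps)
  finally show ?thesis
    using assms by (simp add: measure_pmf.emeasure_eq_measure)
qed

lemma pair_poisson_add:
  assumes "a > 0" "b > 0"
  shows "map_pmf (\<lambda>(x, y). x + y) (pair_pmf (poisson_pmf a) (poisson_pmf b)) = poisson_pmf (a + b)"
proof (rule pmf_eqI)
  fix k :: nat
  have "(\<lambda>(x, y). x + y) -` {k} = (\<lambda>x. (x, k - x)) ` {..k}" by force
  hence "pmf (map_pmf (\<lambda>(x, y). x + y) (pair_pmf (poisson_pmf a) (poisson_pmf b))) k
      = (\<Sum>z\<in>(\<lambda>x. (x, k - x)) ` {..k}. pmf (pair_pmf (poisson_pmf a) (poisson_pmf b)) z)"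
    by (subst pmf_map) (simp add: measure_measure_pmf_finite)
  also have "\<dots> = (\<Sum>x\<le>k. pmf (poisson_pmf a) x * pmf (poisson_pmf b) (k - x))"
    by (subst sum.reindex) (auto simp: inj_on_def pmf_pair)
  also have "\<dots> = (\<Sum>x\<le>k. exp (- (a + b)) / fact k * (real (k choose x) * a ^ x * b ^ (k - x)))"
    using assms by (intro sum.cong refl) (simp add: binomial_fact exp_diff exp_minus field_simps)
  also have "\<dots> = exp (- (a + b)) / fact k * (a + b) ^ k"
    by (simp only: binomial_ring sum_distrib_left)
  also have "\<dots> = pmf (poisson_pmf (a + b)) k"
    using assms by simp
  finally show "pmf (map_pmf (\<lambda>(x, y). x + y) (pair_pmf (poisson_pmf a) (poisson_pmf b))) k
      = pmf (poisson_pmf (a + b)) k" .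
qed

lemma sum_Pi_poisson:
  assumes "finite J" "J \<noteq> {}" "\<And>j. j \<in> J \<Longrightarrow> \<rho> j > 0"
  shows "map_pmf (\<lambda>c. \<Sum>j\<in>J. c j) (Pi_pmf J 0 (\<lambda>j. poisson_pmf (\<rho> j))) = poisson_pmf (\<Sum>j\<in>J. \<rho> j)"
  using assms
proof (induction J rule: finite_ne_induct)
  case (singleton j)
  thus ?case by (simp add: Pi_pmf_singleton map_pmf_comp)
next
  case (insert j J)
  have upd: "(\<Sum>i\<in>insert j J. (h(j := y)) i) = y + (\<Sum>i\<in>J. h i)" for y and h :: "_ \<Rightarrow> nat"
  proof -
    have "(\<Sum>i\<in>J. (h(j := y)) i) = (\<Sum>i\<in>J. h i)"
      using insert.hyps by (intro sum.cong) auto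
    thus ?thesis using insert.hyps by (simp del: fun_upd_apply add: fun_upd_same)
  qed
  have "map_pmf (\<lambda>c. \<Sum>i\<in>insert j J. c i) (Pi_pmf (insert j J) 0 (\<lambda>j. poisson_pmf (\<rho> j)))
      = map_pmf (\<lambda>(y, h). y + (\<Sum>i\<in>J. h i)) (pair_pmf (poisson_pmf (\<rho> j)) (Pi_pmf J 0 (\<lambda>j. poisson_pmf (\<rho> j))))"
  proof -
    have "Pi_pmf (insert j J) 0 (\<lambda>j. poisson_pmf (\<rho> j)) = map_pmf (\<lambda>(y, h). h(j := y))
        (pair_pmf (poisson_pmf (\<rho> j)) (Pi_pmf J 0 (\<lambda>j. poisson_pmf (\<rho> j))))"
      by (rule Pi_pmf_insert) (use insert.hyps in auto)
    thus ?thesis by (simp only: map_pmf_comp case_prod_unfold upd)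
  qed
  also have "\<dots> = map_pmf (\<lambda>(x, y). x + y) (map_pmf (\<lambda>(y, h). (id y, \<Sum>i\<in>J. h i))
      (pair_pmf (poisson_pmf (\<rho> j)) (Pi_pmf J 0 (\<lambda>j. poisson_pmf (\<rho> j)))))"
    by (simp only: map_pmf_comp case_prod_unfold fst_conv snd_conv id_apply)
  also have "\<dots> = map_pmf (\<lambda>(x, y). x + y) (pair_pmf (poisson_pmf (\<rho> j)) (poisson_pmf (\<Sum>i\<in>J. \<rho> i)))"
    using insert.IH insert.prems by (subst map_pair) (simp add: pmf.map_id0 flip: id_def)
  also have "\<dots> = poisson_pmf (\<rho> j + (\<Sum>i\<in>J. \<rho> i))"
    using insert by (intro pair_poisson_add sum_pos) auto
  finally show ?case using insert.hyps by simp
qed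

lemma prob_Pi_pmf_union:
  assumes "finite A" "finite B" "A \<inter> B = {}"
    and P: "\<And>c c'. (\<And>j. j \<in> A \<Longrightarrow> c j = c' j) \<Longrightarrow> P c \<longleftrightarrow> P c'"
    and Q: "\<And>c c'. (\<And>j. j \<in> B \<Longrightarrow> c j = c' j) \<Longrightarrow> Q c \<longleftrightarrow> Q c'"
  shows "measure_pmf.prob (Pi_pmf (A \<union> B) d p) {c. P c \<and> Q c} =
    measure_pmf.prob (Pi_pmf A d p) {c. P c} * measure_pmf.prob (Pi_pmf B d p) {c. Q c}"
proof -
  let ?A = "Pi_pmf A d p" and ?B = "Pi_pmf B d p"
  have "P (\<lambda>x. if x \<in> A then f x else g x) \<longleftrightarrow> P f" "Q (\<lambda>x. if x \<in> A then f x else g x) \<longleftrightarrow> Q g" for f g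
    using assms(3) by (auto intro!: P Q)
  hence "(\<lambda>(f, g) x. if x \<in> A then f x else g x) -` {c. P c \<and> Q c} = {c. P c} \<times> {c. Q c}"
    by auto
  hence "measure_pmf.prob (Pi_pmf (A \<union> B) d p) {c. P c \<and> Q c} =
      measure_pmf.prob (pair_pmf ?A ?B) ({c. P c} \<times> {c. Q c})"
    by (subst Pi_pmf_union[OF assms(1-3)]) (simp only: measure_map_pmf)
  also have "\<dots> = measure_pmf.prob (pair_pmf ?A ?B) (({c. P c} \<inter> set_pmf ?A) \<times> ({c. Q c} \<inter> set_pmf ?B))"
  proof -
    have "({c. P c} \<times> {c. Q c}) \<inter> set_pmf (pair_pmf ?A ?B)
        = ({c. P c} \<inter> set_pmf ?A) \<times> ({c. Q c} \<inter> set_pmf ?B)" by auto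
    thus ?thesis by (metis measure_Int_set_pmf)
  qed
  also have "\<dots> = measure_pmf.prob ?A {c. P c} * measure_pmf.prob ?B {c. Q c}"
    by (subst measure_pmf_prob_product) (auto simp: measure_Int_set_pmf)
  finally show ?thesis .
qed

lemma poisson_atMost:
  assumes "\<mu> > 0"
  shows "measure_pmf.prob (poisson_pmf \<mu>) {..r} = (\<Sum>a\<le>r. \<mu> ^ a / fact a * exp (-\<mu>))"
  using assms by (simp add: measure_measure_pmf_finite)

lemma poisson_atMost_tendsto_0:
  assumes "filterlim \<rho> at_top F"
  shows "((\<lambda>n. measure_pmf.prob (poisson_pmf (\<rho> n)) {..m}) \<longlongrightarrow> 0) F"
proof -
  have "((\<lambda>n. \<Sum>a\<le>m. \<rho> n ^ a / exp (\<rho> n) / fact a) \<longlongrightarrow> (\<Sum>a\<le>m. 0 / fact a)) F"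
    by (intro tendsto_intros filterlim_compose[OF tendsto_power_div_exp_0 assms]) auto
  moreover have "\<forall>\<^sub>F n in F. (\<Sum>a\<le>m. \<rho> n ^ a / exp (\<rho> n) / fact a) = measure_pmf.prob (poisson_pmf (\<rho> n)) {..m}"
    using eventually_compose_filterlim[OF eventually_gt_at_top[of 0] assms]
    by eventually_elim (auto simp: poisson_atMost exp_minus field_simps)
  ultimately show ?thesis by (simp add: tendsto_cong)
qed

text \<open>
  The Poisson limit of rare events, by \<open>- q - 2 q\<^sup>2 \<le> ln (1 - q) \<le> - q\<close>.
\<close>

lemma power_one_minus_tendsto:
  fixes q :: "nat \<Rightarrow> real"
  assumes "\<And>n. 0 \<le> q n" and lim: "(\<lambda>n. real n * q n) \<longlonglongrightarrow> L"
  shows "(\<lambda>n. (1 - q n) ^ n) \<longlonglongrightarrow> exp (- L)"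
proof -
  have "(\<lambda>n. real n * q n * (1 / real n)) \<longlonglongrightarrow> L * 0"
    by (intro tendsto_mult lim lim_1_over_n)
  moreover have "\<forall>\<^sub>F n in sequentially. real n * q n * (1 / real n) = q n"
    using eventually_gt_at_top[of 0] by eventually_elim auto
  ultimately have q0: "q \<longlonglongrightarrow> 0" by (simp add: tendsto_cong)
  have small: "\<forall>\<^sub>F n in sequentially. q n < 1 / 2"
    using order_tendstoD(2)[OF q0, of "1/2"] by simp
  have "(\<lambda>n. - (real n * q n) - 2 * ((real n * q n) * q n)) \<longlonglongrightarrow> - L - 2 * (L * 0)"
    by (intro tendsto_intros lim q0)
  hence "(\<lambda>n. - (real n * q n) - 2 * ((real n * q n) * q n)) \<longlonglongrightarrow> - L"
    by simp
  hence "(\<lambda>n. real n * ln (1 - q n)) \<longlonglongrightarrow> - L"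
  proof (rule real_tendsto_sandwich[rotated 2])
    show "\<forall>\<^sub>F n in sequentially. - (real n * q n) - 2 * ((real n * q n) * q n) \<le> real n * ln (1 - q n)"
      using small
    proof eventually_elim
      case (elim n)
      have "real n * (- q n - 2 * (q n)\<^sup>2) \<le> real n * ln (1 - q n)"
        using elim assms(1)[of n] by (intro mult_left_mono ln_one_minus_pos_lower_bound) auto
      thus ?case by (simp add: algebra_simps power2_eq_square)
    qed
    show "\<forall>\<^sub>F n in sequentially. real n * ln (1 - q n) \<le> - (real n * q n)"
      using small
    proof eventually_elim
      case (elim n)
      have "ln (1 - q n) \<le> - q n" using ln_add_one_self_le_self2[of "- q n"] elim by simp
      hence "real n * ln (1 - q n) \<le> real n * (- q n)" by (rule mult_left_mono) auto
      thus ?case by simp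
    qed
    show "(\<lambda>n. - (real n * q n)) \<longlonglongrightarrow> - L" by (intro tendsto_intros lim)
  qed
  hence "(\<lambda>n. exp (real n * ln (1 - q n))) \<longlonglongrightarrow> exp (- L)" by (rule tendsto_exp)
  moreover have "\<forall>\<^sub>F n in sequentially. exp (real n * ln (1 - q n)) = (1 - q n) ^ n"
    using small by eventually_elim (simp add: exp_of_nat_mult)
  ultimately show ?thesis by (simp add: tendsto_cong)
qed

section \<open>Asymptotics of the Poissonized collection\<close>

text \<open>
  The mean number of coupons of one type in block \<open>j\<close>.  The rates are the increments of
  \<open>ln n + r ln ln n + y r\<close>, which is the deadline of collector \<open>r\<close> divided by \<open>n\<close> and hence the
  mean count of one type at that deadline.
\<close>

definition block_rate :: "nat \<Rightarrow> (nat \<Rightarrow> real) \<Rightarrow> nat \<Rightarrow> real" where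
  "block_rate n y j = (if j = 0 then ln (real n) + y 0 else ln (ln (real n)) + y j - y (j - 1))"

lemma sum_block_rate: "(\<Sum>j\<le>r. block_rate n y j) = ln (real n) + real r * ln (ln (real n)) + y r"
  by (induction r) (auto simp: block_rate_def algebra_simps)

lemma block_rate_at_top: "filterlim (\<lambda>n. block_rate n y j) at_top sequentially"
proof (cases j)
  case 0
  have "filterlim (\<lambda>n. ln (real n) + y 0) at_top sequentially" by real_asymp
  thus ?thesis using 0 by (simp add: block_rate_def)
next
  case (Suc i)
  have "filterlim (\<lambda>n. ln (ln (real n)) + c) at_top sequentially" for c :: real by real_asymp
  from this[of "y j - y (j - 1)"] show ?thesis using Suc by (simp add: block_rate_def add_diff_eq)
qed

lemma block_rate_sublinear: "(\<lambda>n. block_rate n y j / real n) \<longlonglongrightarrow> 0"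
proof (cases j)
  case 0
  have "(\<lambda>n. (ln (real n) + y 0) / real n) \<longlonglongrightarrow> 0" by real_asymp
  thus ?thesis using 0 by (simp add: block_rate_def)
next
  case (Suc i)
  have "(\<lambda>n. (ln (ln (real n)) + c) / real n) \<longlonglongrightarrow> 0" for c :: real by real_asymp
  from this[of "y j - y (j - 1)"] show ?thesis using Suc by (simp add: block_rate_def add_diff_eq)
qed

lemma eventually_block_rate_pos: "\<forall>\<^sub>F n in sequentially. \<forall>j\<le>m. block_rate n y j > 0"
proof -
  have "\<forall>\<^sub>F n in sequentially. \<forall>j\<in>{..m}. block_rate n y j > 0"
    by (intro eventually_ball_finite ballI)
       (use block_rate_at_top in \<open>auto simp: filterlim_at_top_dense\<close>)
  thus ?thesis by (simp add: Ball_def)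
qed

text \<open>
  For the mean \<open>s = ln n + r ln ln n + x\<close> one has \<open>n exp (- s) = exp (- x) / (ln n)\<^sup>r\<close>, while
  \<open>s\<^sup>a\<close> grows like \<open>(ln n)\<^sup>a\<close>: of the terms \<open>a \<le> r\<close> only \<open>a = r\<close> survives in the limit.
\<close>

lemma poisson_tail_critical:
  fixes x :: real and r :: nat
  defines "s \<equiv> \<lambda>n. ln (real n) + real r * ln (ln (real n)) + x"
  shows "(\<lambda>n. real n * measure_pmf.prob (poisson_pmf (s n)) {..r}) \<longlonglongrightarrow> exp (- x) / fact r"
proof -
  have s_top: "filterlim s at_top sequentially"
    unfolding s_def by real_asymp
  have ratio: "(\<lambda>n. s n / ln (real n)) \<longlonglongrightarrow> 1"
    unfolding s_def by real_asymp
  have inv: "(\<lambda>n. 1 / ln (real n)) \<longlonglongrightarrow> 0" by real_asymp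
  have "(\<lambda>n. \<Sum>a\<le>r. exp (-x) * ((s n / ln (real n)) ^ a * (1 / ln (real n)) ^ (r - a) / fact a))
      \<longlonglongrightarrow> (\<Sum>a\<le>r. exp (-x) * (1 ^ a * 0 ^ (r - a) / fact a))"
    by (intro tendsto_intros ratio inv) auto
  also have "(\<Sum>a\<le>r. exp (-x) * (1 ^ a * 0 ^ (r - a) / fact a)) = (\<Sum>a\<in>{r}. exp (-x) / fact a)"
    by (intro sum.mono_neutral_cong_right) auto
  finally have lim: "(\<lambda>n. \<Sum>a\<le>r. exp (-x) * ((s n / ln (real n)) ^ a * (1 / ln (real n)) ^ (r - a) / fact a))
      \<longlonglongrightarrow> exp (- x) / fact r" by simp
  have pos: "\<forall>\<^sub>F n in sequentially. s n > 0"
    using s_top by (auto simp: filterlim_at_top_dense)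
  have "\<forall>\<^sub>F n in sequentially. ln (real n) > 0" by real_asymp
  with pos eventually_gt_at_top[of "0::nat"]
  have "\<forall>\<^sub>F n in sequentially.
      (\<Sum>a\<le>r. exp (-x) * ((s n / ln (real n)) ^ a * (1 / ln (real n)) ^ (r - a) / fact a))
        = real n * measure_pmf.prob (poisson_pmf (s n)) {..r}"
  proof eventually_elim
    case (elim n)
    have "exp (real r * ln (ln (real n))) = ln (real n) ^ r"
      using elim by (simp add: exp_of_nat_mult)
    hence e: "exp (- s n) = exp (- x) / (real n * ln (real n) ^ r)"
      unfolding s_def exp_minus exp_add using elim by (simp add: field_simps)
    show ?case
      unfolding poisson_atMost[OF elim(1)] sum_distrib_left
    proof (intro sum.cong refl)
      fix a assume "a \<in> {..r}"
      hence "ln (real n) ^ r = ln (real n) ^ a * ln (real n) ^ (r - a)"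
        by (simp add: power_add[symmetric])
      thus "exp (-x) * ((s n / ln (real n)) ^ a * (1 / ln (real n)) ^ (r - a) / fact a)
          = real n * (s n ^ a / fact a * exp (- s n))"
        using elim unfolding e by (simp add: power_divide field_simps)
    qed
  qed
  with lim show ?thesis by (simp add: tendsto_cong)
qed

text \<open>
  The probability, in the Poissonized model, that a given type is late for some label in \<open>I\<close>.
\<close>

definition miss_prob :: "nat \<Rightarrow> (nat \<Rightarrow> real) \<Rightarrow> nat set \<Rightarrow> nat \<Rightarrow> real" where
  "miss_prob m y I n = measure_pmf.prob (Pi_pmf {..m} 0 (\<lambda>j. poisson_pmf (block_rate n y j)))
     {c. \<exists>r\<in>I. (\<Sum>j\<le>r. c j) \<le> r}"

text \<open>
  The union bound is sharp.  Being late for \<open>r\<close> and then receiving more than \<open>m\<close> coupons in every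
  later block are disjoint events for different \<open>r\<close>, and the second requirement costs nothing in
  the limit because the later rates tend to infinity.
\<close>

lemma miss_prob_tendsto:
  assumes I: "I \<subseteq> {..m}"
  shows "(\<lambda>n. real n * miss_prob m y I n) \<longlonglongrightarrow> (\<Sum>r\<in>I. exp (- y r) / fact r)"
proof -
  define p where "p n = Pi_pmf {..m} 0 (\<lambda>j. poisson_pmf (block_rate n y j))" for n
  define late where "late n r = measure_pmf.prob (poisson_pmf (ln (real n) + real r * ln (ln (real n)) + y r)) {..r}" for n r
  define fill where "fill n r = (\<Prod>j\<in>{r<..m}. 1 - measure_pmf.prob (poisson_pmf (block_rate n y j)) {..m})" for n r
  have finI: "finite I" using I by (rule finite_subset) simp

  have marginal: "measure_pmf.prob (Pi_pmf {..r} 0 (\<lambda>j. poisson_pmf (block_rate n y j))) {c. (\<Sum>j\<le>r. c j) \<le> r} = late n r"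
    if "\<forall>j\<le>m. block_rate n y j > 0" "r \<le> m" for n r
  proof -
    have "map_pmf (\<lambda>c. \<Sum>j\<le>r. c j) (Pi_pmf {..r} 0 (\<lambda>j. poisson_pmf (block_rate n y j)))
        = poisson_pmf (\<Sum>j\<le>r. block_rate n y j)"
      using that by (intro sum_Pi_poisson) auto
    from arg_cong[OF this, of "\<lambda>q. measure_pmf.prob q {..r}"] show ?thesis
      by (simp add: late_def sum_block_rate vimage_def)
  qed
  have split: "measure_pmf.prob (p n) {c. (\<Sum>j\<le>r. c j) \<le> r \<and> (\<forall>j\<in>{r<..m}. m < c j)} = late n r * fill n r"
    if pos: "\<forall>j\<le>m. block_rate n y j > 0" and r: "r \<le> m" for n r
  proof -
    let ?q = "\<lambda>j. poisson_pmf (block_rate n y j)"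
    have compl: "measure_pmf.prob q {m<..} = 1 - measure_pmf.prob q {..m}" for q :: "nat pmf"
    proof -
      have "{m<..} = UNIV - {..m}" by auto
      thus ?thesis using measure_pmf.prob_compl[of "{..m}" q] by simp
    qed
    have un: "{..m} = {..r} \<union> {r<..m}" using r by auto
    have "measure_pmf.prob (p n) {c. (\<Sum>j\<le>r. c j) \<le> r \<and> (\<forall>j\<in>{r<..m}. m < c j)} =
        measure_pmf.prob (Pi_pmf {..r} 0 ?q) {c. (\<Sum>j\<le>r. c j) \<le> r} *
        measure_pmf.prob (Pi_pmf {r<..m} 0 ?q) {c. \<forall>j\<in>{r<..m}. m < c j}"
      unfolding p_def un by (intro prob_Pi_pmf_union) auto
    also have "{c. \<forall>j\<in>{r<..m}. m < c j} = Pi {r<..m} (\<lambda>_. {m<..})" by auto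
    also have "measure_pmf.prob (Pi_pmf {r<..m} 0 ?q) \<dots> = fill n r"
      unfolding fill_def by (subst measure_Pi_pmf_Pi) (auto simp: compl)
    finally show ?thesis using pos r by (simp add: marginal)
  qed
  have marginal': "measure_pmf.prob (p n) {c. (\<Sum>j\<le>r. c j) \<le> r} = late n r"
    if pos: "\<forall>j\<le>m. block_rate n y j > 0" and r: "r \<le> m" for n r
  proof -
    have un: "{..m} = {..r} \<union> {r<..m}" using r by auto
    have "measure_pmf.prob (p n) {c. (\<Sum>j\<le>r. c j) \<le> r \<and> True} =
        measure_pmf.prob (Pi_pmf {..r} 0 (\<lambda>j. poisson_pmf (block_rate n y j))) {c. (\<Sum>j\<le>r. c j) \<le> r} *
        measure_pmf.prob (Pi_pmf {r<..m} 0 (\<lambda>j. poisson_pmf (block_rate n y j))) {c. True}"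
      unfolding p_def un by (intro prob_Pi_pmf_union) auto
    thus ?thesis using pos r by (simp add: marginal)
  qed

  have upper: "miss_prob m y I n \<le> (\<Sum>r\<in>I. late n r)" if "\<forall>j\<le>m. block_rate n y j > 0" for n
  proof -
    have "miss_prob m y I n = measure_pmf.prob (p n) (\<Union>r\<in>I. {c. (\<Sum>j\<le>r. c j) \<le> r})"
      unfolding miss_prob_def p_def by (intro arg_cong2[where f = measure]) auto
    also have "\<dots> \<le> (\<Sum>r\<in>I. measure_pmf.prob (p n) {c. (\<Sum>j\<le>r. c j) \<le> r})"
      using finI by (intro measure_pmf.finite_measure_subadditive_finite) auto
    also have "\<dots> = (\<Sum>r\<in>I. late n r)"
      using that I by (intro sum.cong refl marginal') auto
    finally show ?thesis .
  qed
  have lower: "(\<Sum>r\<in>I. late n r * fill n r) \<le> miss_prob m y I n" if "\<forall>j\<le>m. block_rate n y j > 0" for n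
  proof -
    let ?E = "\<lambda>r. {c. (\<Sum>j\<le>r. c j) \<le> r \<and> (\<forall>j\<in>{r<..m}. m < c j)}"
    have disj: "?E r \<inter> ?E r' = {}" if "r < r'" "r' \<le> m" for r r'
    proof (rule equals0I)
      fix c assume "c \<in> ?E r \<inter> ?E r'"
      hence "m < c r'" "(\<Sum>j\<le>r'. c j) \<le> r'" using that by auto
      moreover have "c r' \<le> (\<Sum>j\<le>r'. c j)" by (rule member_le_sum) auto
      ultimately show False using that by linarith
    qed
    have "(\<Sum>r\<in>I. late n r * fill n r) = (\<Sum>r\<in>I. measure_pmf.prob (p n) (?E r))"
      using that I by (intro sum.cong refl split[symmetric]) auto
    also have "\<dots> = measure_pmf.prob (p n) (\<Union>r\<in>I. ?E r)"
    proof (rule measure_pmf.finite_measure_finite_Union[symmetric, OF finI])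
      show "disjoint_family_on ?E I"
        unfolding disjoint_family_on_def
      proof (intro ballI impI)
        fix r r' assume "r \<in> I" "r' \<in> I" "r \<noteq> r'"
        thus "?E r \<inter> ?E r' = {}"
          using disj[of r r'] disj[of r' r] I by (cases r r' rule: linorder_cases) auto
      qed
    qed auto
    also have "\<dots> \<le> miss_prob m y I n"
      unfolding miss_prob_def p_def by (intro measure_pmf.finite_measure_mono) auto
    finally show ?thesis .
  qed

  have late: "(\<lambda>n. real n * late n r) \<longlonglongrightarrow> exp (- y r) / fact r" for r
    unfolding late_def by (rule poisson_tail_critical)
  have "(\<lambda>n. fill n r) \<longlonglongrightarrow> (\<Prod>j\<in>{r<..m}. 1 - 0)" for r
    unfolding fill_def by (intro tendsto_intros poisson_atMost_tendsto_0 block_rate_at_top)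
  hence fill: "(\<lambda>n. fill n r) \<longlonglongrightarrow> 1" for r by simp
  show ?thesis
  proof (rule real_tendsto_sandwich)
    show "\<forall>\<^sub>F n in sequentially. (\<Sum>r\<in>I. real n * late n r * fill n r) \<le> real n * miss_prob m y I n"
      using eventually_block_rate_pos[of m y]
    proof eventually_elim
      case (elim n)
      from mult_left_mono[OF lower[OF elim], of "real n"] show ?case
        by (simp add: sum_distrib_left mult.assoc)
    qed
    show "\<forall>\<^sub>F n in sequentially. real n * miss_prob m y I n \<le> (\<Sum>r\<in>I. real n * late n r)"
      using eventually_block_rate_pos[of m y]
    proof eventually_elim
      case (elim n)
      from mult_left_mono[OF upper[OF elim], of "real n"] show ?case
        by (simp add: sum_distrib_left)
    qed
    show "(\<lambda>n. \<Sum>r\<in>I. real n * late n r) \<longlonglongrightarrow> (\<Sum>r\<in>I. exp (- y r) / fact r)"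
      by (intro tendsto_intros late)
    have "(\<lambda>n. \<Sum>r\<in>I. real n * late n r * fill n r) \<longlonglongrightarrow> (\<Sum>r\<in>I. exp (- y r) / fact r * 1)"
      by (intro tendsto_intros late fill)
    thus "(\<lambda>n. \<Sum>r\<in>I. real n * late n r * fill n r) \<longlonglongrightarrow> (\<Sum>r\<in>I. exp (- y r) / fact r)" by simp
  qed
qed

corollary poissonized_limit:
  assumes "I \<subseteq> {..m}"
  shows "(\<lambda>n. measure_pmf.prob (Pi_pmf {..m} 0 (\<lambda>j. poisson_pmf (block_rate n y j)))
      {c. \<forall>r\<in>I. r < (\<Sum>j\<le>r. c j)} ^ n) \<longlonglongrightarrow> exp (- (\<Sum>r\<in>I. exp (- y r) / fact r))"
proof -
  have "(\<lambda>n. (1 - miss_prob m y I n) ^ n) \<longlonglongrightarrow> exp (- (\<Sum>r\<in>I. exp (- y r) / fact r))"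
    using assms by (intro power_one_minus_tendsto miss_prob_tendsto) (simp add: miss_prob_def)
  also have "(\<lambda>n. 1 - miss_prob m y I n) = (\<lambda>n. measure_pmf.prob (Pi_pmf {..m} 0 (\<lambda>j. poisson_pmf (block_rate n y j)))
      {c. \<forall>r\<in>I. r < (\<Sum>j\<le>r. c j)})"
  proof
    fix n
    let ?A = "{c. \<exists>r\<in>I. (\<Sum>j\<le>r. c j) \<le> (r :: nat)}"
    have compl: "{c. \<forall>r\<in>I. r < (\<Sum>j\<le>r. c j)} = UNIV - ?A"
      by (auto simp: not_le)
    show "1 - miss_prob m y I n = measure_pmf.prob (Pi_pmf {..m} 0 (\<lambda>j. poisson_pmf (block_rate n y j)))
      {c. \<forall>r\<in>I. r < (\<Sum>j\<le>r. c j)}"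
      unfolding compl miss_prob_def
      using measure_pmf.prob_compl[of ?A "Pi_pmf {..m} 0 (\<lambda>j. poisson_pmf (block_rate n y j))"] by simp
  qed
  finally show ?thesis .
qed

section \<open>Arrival times and counts\<close>

lemma type_counts_mono: "finite S' \<Longrightarrow> S \<subseteq> S' \<Longrightarrow> type_counts S c i \<le> type_counts S' c i"
  unfolding type_counts_def by (intro card_mono) auto

lemma type_counts_atLeastAtMost_Suc:
  "type_counts {1..Suc t} c i = type_counts {1..t} c i + (if c (Suc t) = i then 1 else 0)"
proof -
  have "{k \<in> {1..Suc t}. c k = i} = (if c (Suc t) = i then insert (Suc t) {k \<in> {1..t}. c k = i} else {k \<in> {1..t}. c k = i})"
    by (auto simp: le_Suc_eq)
  thus ?thesis by (simp add: type_counts_def)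
qed

lemma type_counts_Suc_le: "type_counts {1..Suc t} c i \<le> type_counts {1..t} c i + 1"
  unfolding type_counts_atLeastAtMost_Suc by simp

text \<open>
  Counts grow by at most one per step, so a count above \<open>r\<close> has passed through \<open>r + 1\<close> exactly.
\<close>

lemma arrival_time_le:
  assumes "r < type_counts {1..t} c i"
  shows "arrival_time c i r \<le> t"
proof -
  have "\<exists>k\<le>t. type_counts {1..k} c i = r + 1"
    using assms
  proof (induction t)
    case 0
    thus ?case by (simp add: type_counts_def)
  next
    case (Suc t)
    show ?case
    proof (cases "r < type_counts {1..t} c i")
      case True
      thus ?thesis using Suc.IH le_SucI by blast
    next
      case False
      hence "type_counts {1..Suc t} c i = r + 1"
        using Suc.prems type_counts_Suc_le[of t c i] by linarith
      thus ?thesis by blast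
    qed
  qed
  then obtain k where "k \<le> t" "type_counts {1..k} c i = r + 1" by blast
  moreover from this have "arrival_time c i r \<le> k"
    unfolding arrival_time_def type_counts_def by (intro Least_le)
  ultimately show ?thesis by simp
qed

text \<open>
  The second hypothesis says that the coupon does arrive at some time; otherwise
  \<open>arrival_time c i r\<close> is an unspecified number that carries no information about counts.
\<close>

lemma less_type_counts_if_arrival_time_le:
  assumes "arrival_time c i r \<le> t" and "r < type_counts {1..t'} c i"
  shows "r < type_counts {1..t} c i"
proof -
  have "\<exists>k. type_counts {1..k} c i = r + 1"
  proof (rule ccontr)
    assume no: "\<nexists>k. type_counts {1..k} c i = r + 1"
    have "type_counts {1..k} c i \<le> r" for k
    proof (induction k)
      case 0
      thus ?case by (simp add: type_counts_def)
    next
      case (Suc k)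
      moreover have "type_counts {1..Suc k} c i \<noteq> r + 1" using no by blast
      ultimately show ?case using type_counts_Suc_le[of k c i] by linarith
    qed
    thus False using assms(2) by (simp add: not_le[symmetric])
  qed
  hence "type_counts {1..arrival_time c i r} c i = r + 1"
    unfolding arrival_time_def type_counts_def by (rule LeastI_ex)
  moreover have "type_counts {1..arrival_time c i r} c i \<le> type_counts {1..t} c i"
    using assms(1) by (intro type_counts_mono) auto
  ultimately show ?thesis by simp
qed

section \<open>De-Poissonization\<close>

locale coupon_collector =
  fixes M :: "nat \<Rightarrow> 'a measure" and X :: "nat \<Rightarrow> nat \<Rightarrow> 'a \<Rightarrow> nat"
  assumes coupon_space: "\<And>n. n \<ge> 1 \<Longrightarrow> prob_space (M n)"
    and coupon_indep: "\<And>n. n \<ge> 1 \<Longrightarrow>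
          prob_space.indep_vars (M n) (\<lambda>_. count_space UNIV) (X n) {1..}"
    and coupon_uniform: "\<And>n k. n \<ge> 1 \<Longrightarrow> k \<ge> 1 \<Longrightarrow>
          distr (M n) (count_space UNIV) (X n k) = measure_pmf (pmf_of_set {1..n})"
begin

definition collected :: "nat \<Rightarrow> nat set \<Rightarrow> (nat \<Rightarrow> nat) \<Rightarrow> 'a set" where
  "collected n I t = {\<omega> \<in> space (M n). \<forall>i\<in>{1..n}. \<forall>r\<in>I. r < type_counts {1..t r} (\<lambda>k. X n k \<omega>) i}"

lemma measurable_type_counts:
  assumes "n \<ge> 1"
  shows "(\<lambda>\<omega>. type_counts {1..t} (\<lambda>k. X n k \<omega>) i) \<in> measurable (M n) (count_space UNIV)"
  unfolding type_counts_def
proof (rule measurable_card)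
  interpret prob_space "M n" using assms by (rule coupon_space)
  fix k
  have "X n k -` {i} \<inter> space (M n) \<in> sets (M n)" if "k \<in> {1..t}"
  proof (rule measurable_sets)
    show "X n k \<in> measurable (M n) (count_space UNIV)"
      using coupon_indep[OF assms] that by (simp add: indep_vars_def)
  qed simp
  moreover have "{\<omega> \<in> space (M n). k \<in> {k \<in> {1..t}. X n k \<omega> = i}}
      = (if k \<in> {1..t} then X n k -` {i} \<inter> space (M n) else {})"
    by auto
  ultimately show "{\<omega> \<in> space (M n). k \<in> {k \<in> {1..t}. X n k \<omega> = i}} \<in> sets (M n)"
    by (simp only: sets.empty_sets split: if_split) blast
qed

lemma collected_sets:
  assumes "n \<ge> 1" "finite I"
  shows "collected n I t \<in> sets (M n)"
proof -
  have "{\<omega> \<in> space (M n). r < type_counts {1..t r} (\<lambda>k. X n k \<omega>) i} \<in> sets (M n)" for r i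
    using measurable_sets[OF measurable_type_counts[OF assms(1), of "t r" i], of "{r<..}"]
    by (simp add: vimage_def Int_def conj_commute)
  thus ?thesis
    unfolding collected_def using assms(2) by (intro sets.sets_Collect_finite_All) auto
qed

lemma prob_collected_mono:
  assumes "n \<ge> 1" "finite I" "\<And>r. r \<in> I \<Longrightarrow> t r \<le> t' r"
  shows "measure (M n) (collected n I t) \<le> measure (M n) (collected n I t')"
proof -
  interpret prob_space "M n" using assms(1) by (rule coupon_space)
  have le: "type_counts {1..t r} c i \<le> type_counts {1..t' r} c i" if "r \<in> I" for r c i
    using assms(3)[OF that] by (intro type_counts_mono) auto
  have "collected n I t \<subseteq> collected n I t'"
    unfolding collected_def by (safe, rule order.strict_trans2[OF _ le]) blast+
  thus ?thesis using collected_sets[OF assms(1,2)] by (intro finite_measure_mono) auto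
qed

text \<open>
  Outside an event of small probability the Poisson block lengths dominate block lengths \<open>d\<close>
  that lie below their means by \<open>n \<delta>\<close>, and they are dominated by \<open>d\<close> if \<open>d\<close> exceeds the means by
  \<open>n \<delta>\<close>.  The probability of a complete collection is monotone in the block lengths, so averaging
  over the Poisson lengths compares it with the Poissonized probability \<open>q\<close>.
\<close>

lemma poissonized_sandwich:
  fixes d :: "nat \<Rightarrow> nat" and \<rho> :: "nat \<Rightarrow> real" and I m n
  defines "g \<equiv> \<lambda>d. measure (M n) (collected n I (\<lambda>r. \<Sum>j\<le>r. d j))"
    and "q \<equiv> measure_pmf.prob (Pi_pmf {..m} 0 (\<lambda>j. poisson_pmf (\<rho> j))) {c. \<forall>r\<in>I. r < (\<Sum>j\<le>r. c j)} ^ n"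
  assumes n: "n \<ge> 1" and I: "I \<subseteq> {..m}" and \<rho>: "\<And>j. j \<le> m \<Longrightarrow> \<rho> j > 0" and \<delta>: "\<delta> > 0"
  shows "(\<And>j. j \<le> m \<Longrightarrow> real (d j) \<le> real n * \<rho> j - real n * \<delta>) \<Longrightarrow> g d \<le> q + (\<Sum>j\<le>m. \<rho> j / real n) / \<delta>\<^sup>2"
    and "(\<And>j. j \<le> m \<Longrightarrow> real n * \<rho> j + real n * \<delta> \<le> real (d j)) \<Longrightarrow> q \<le> g d + (\<Sum>j\<le>m. \<rho> j / real n) / \<delta>\<^sup>2"
proof -
  interpret prob_space "M n" using n by (rule coupon_space)
  define p where "p = Pi_pmf {..m} 0 (\<lambda>j. poisson_pmf (real n * \<rho> j))"
  define bad where "bad j = {D :: nat \<Rightarrow> nat. real n * \<delta> \<le> \<bar>real (D j) - real n * \<rho> j\<bar>}" for j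
  define Bad where "Bad = (\<Union>j\<le>m. bad j)"
  have finI: "finite I" using I by (rule finite_subset) simp
  have g_eq: "g D = measure_pmf.prob (Pi_pmf {..m} (\<lambda>_. 0) (\<lambda>j. multinomial_pmf n (D j)))
      {C. \<forall>i\<in>{1..n}. \<forall>r\<in>I. r < (\<Sum>j\<le>r. C j i)}" for D
    unfolding g_def collected_def
    by (rule prob_all_types_collected[OF coupon_indep[OF n] coupon_uniform[OF n] n I])
  have mean: "measure_pmf.expectation p g = q"
    unfolding g_eq p_def q_def
    by (rule poissonized_prob[where P = "\<lambda>c. \<forall>r\<in>I. r < (\<Sum>j\<le>r. c j)"]) (use n \<rho> in auto)
  have "measure_pmf.prob p (bad j) \<le> \<rho> j / real n / \<delta>\<^sup>2" if "j \<le> m" for j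
  proof -
    have "measure_pmf.prob p (bad j) = measure_pmf.prob (map_pmf (\<lambda>D. D j) p) {k. real n * \<delta> \<le> \<bar>real k - real n * \<rho> j\<bar>}"
      by (simp add: bad_def vimage_def)
    also have "map_pmf (\<lambda>D. D j) p = poisson_pmf (real n * \<rho> j)"
      using that by (simp add: p_def Pi_pmf_component)
    also have "measure_pmf.prob \<dots> {k. real n * \<delta> \<le> \<bar>real k - real n * \<rho> j\<bar>} \<le> real n * \<rho> j / (real n * \<delta>)\<^sup>2"
      using n \<rho>[OF that] \<delta> by (intro poisson_deviation) auto
    also have "\<dots> = \<rho> j / real n / \<delta>\<^sup>2" using n by (simp add: power2_eq_square)
    finally show ?thesis .
  qed
  hence "(\<Sum>j\<le>m. measure_pmf.prob p (bad j)) \<le> (\<Sum>j\<le>m. \<rho> j / real n) / \<delta>\<^sup>2"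
    unfolding sum_divide_distrib by (intro sum_mono) auto
  moreover have "measure_pmf.prob p Bad \<le> (\<Sum>j\<le>m. measure_pmf.prob p (bad j))"
    unfolding Bad_def by (intro measure_pmf.finite_measure_subadditive_finite) auto
  ultimately have Bad: "measure_pmf.prob p Bad \<le> (\<Sum>j\<le>m. \<rho> j / real n) / \<delta>\<^sup>2" by linarith
  have int: "integrable (measure_pmf p) g" "integrable (measure_pmf p) (indicator Bad :: _ \<Rightarrow> real)"
    by (auto intro!: measure_pmf.integrable_const_bound[where B = 1] simp: g_def indicator_def)
  have mono: "g D \<le> g D'" if "\<And>j. j \<le> m \<Longrightarrow> D j \<le> D' j" for D D'
    unfolding g_def using that I by (intro prob_collected_mono n finI sum_mono) auto
  have g01: "0 \<le> g D" "g D \<le> 1" for D by (simp_all add: g_def)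
  have close: "\<bar>real (D j) - real n * \<rho> j\<bar> < real n * \<delta>" if "D \<notin> Bad" "j \<le> m" for D j
  proof -
    have "D \<notin> bad j" using that by (auto simp: Bad_def)
    thus ?thesis by (simp add: bad_def)
  qed
  show "g d \<le> q + (\<Sum>j\<le>m. \<rho> j / real n) / \<delta>\<^sup>2"
    if d: "\<And>j. j \<le> m \<Longrightarrow> real (d j) \<le> real n * \<rho> j - real n * \<delta>"
  proof -
    have "measure_pmf.expectation p (\<lambda>_. g d) \<le> measure_pmf.expectation p (\<lambda>D. g D + indicator Bad D)"
    proof (intro integral_mono Bochner_Integration.integrable_add int)
      fix D
      show "g d \<le> g D + indicator Bad D"
      proof (cases "D \<in> Bad")
        case False
        have "d j \<le> D j" if "j \<le> m" for j
          using close[OF False that] d[OF that] by linarith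
        thus ?thesis using False by (simp add: mono)
      next
        case True
        thus ?thesis using g01[of d] g01[of D] by simp
      qed
    qed auto
    thus ?thesis using int Bad by (simp add: mean)
  qed
  show "q \<le> g d + (\<Sum>j\<le>m. \<rho> j / real n) / \<delta>\<^sup>2"
    if d: "\<And>j. j \<le> m \<Longrightarrow> real n * \<rho> j + real n * \<delta> \<le> real (d j)"
  proof -
    have "measure_pmf.expectation p g \<le> measure_pmf.expectation p (\<lambda>D. g d + indicator Bad D)"
    proof (intro integral_mono Bochner_Integration.integrable_add int)
      fix D
      show "g D \<le> g d + indicator Bad D"
      proof (cases "D \<in> Bad")
        case False
        have "D j \<le> d j" if "j \<le> m" for j
          using close[OF False that] d[OF that] by linarith
        thus ?thesis using False by (simp add: mono)
      next
        case True
        thus ?thesis using g01[of d] g01[of D] by simp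
      qed
    qed auto
    thus ?thesis using int Bad by (simp add: mean)
  qed
qed

end

definition real_threshold :: "nat \<Rightarrow> (nat \<Rightarrow> real) \<Rightarrow> nat \<Rightarrow> real" where
  "real_threshold n x r = real n * (ln (real n) + real r * ln (ln (real n)) + x r)"

definition threshold :: "nat \<Rightarrow> (nat \<Rightarrow> real) \<Rightarrow> nat \<Rightarrow> nat" where
  "threshold n x r = nat \<lfloor>real_threshold n x r\<rfloor>"

text \<open>
  The block lengths of consecutive times, with the first block starting at time \<open>0\<close>.  The
  subtraction is truncated, so they are meaningful only for increasing times.
\<close>

definition increment :: "(nat \<Rightarrow> nat) \<Rightarrow> nat \<Rightarrow> nat" where
  "increment t j = (if j = 0 then t 0 else t j - t (j - 1))"

lemma sum_increment:
  assumes "\<And>j. j < m \<Longrightarrow> t j \<le> t (Suc j)" "r \<le> m"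
  shows "(\<Sum>j\<le>r. increment t j) = t r"
  using assms(2)
proof (induction r)
  case (Suc r)
  thus ?case using assms(1)[of r] by (simp add: increment_def)
qed (simp add: increment_def)

text \<open>
  Consecutive deadlines are about \<open>n ln ln n\<close> apart, which outweighs any fixed difference of
  the values of \<open>x\<close>.
\<close>

lemma eventually_threshold:
  "\<forall>\<^sub>F n in sequentially. \<forall>j\<le>m. 0 \<le> real_threshold n x j \<and> threshold n x j \<le> threshold n x (Suc j)"
proof -
  have "\<forall>\<^sub>F n in sequentially. \<forall>j\<in>{..m}. 0 \<le> real_threshold n x j \<and> threshold n x j \<le> threshold n x (Suc j)"
  proof (intro eventually_ball_finite ballI)
    fix j
    have 1: "\<forall>\<^sub>F n in sequentially. 0 \<le> ln (real n) + real j * ln (ln (real n)) + x j"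
      by real_asymp
    have 2: "\<forall>\<^sub>F n in sequentially. 0 \<le> ln (ln (real n)) + (x (Suc j) - x j)"
      by real_asymp
    from 1 2 show "\<forall>\<^sub>F n in sequentially. 0 \<le> real_threshold n x j \<and> threshold n x j \<le> threshold n x (Suc j)"
    proof eventually_elim
      case (elim n)
      have "real_threshold n x j \<le> real_threshold n x (Suc j)"
        unfolding real_threshold_def using elim by (intro mult_left_mono) (auto simp: algebra_simps)
      thus ?case using elim
        by (auto simp: threshold_def real_threshold_def intro!: nat_mono floor_mono)
    qed
  qed auto
  thus ?thesis by (simp add: Ball_def)
qed

lemma increment_threshold:
  assumes "0 \<le> real_threshold n x j" "j > 0 \<Longrightarrow> 0 \<le> real_threshold n x (j - 1)"
    "j > 0 \<Longrightarrow> threshold n x (j - 1) \<le> threshold n x j"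
  shows "\<bar>real (increment (threshold n x) j) - real n * block_rate n x j\<bar> \<le> 1"
proof -
  have floor: "real (threshold n x k) \<le> real_threshold n x k \<and> real_threshold n x k < real (threshold n x k) + 1"
    if "0 \<le> real_threshold n x k" for k
    using that unfolding threshold_def by (simp add: le_nat_floor)
  show ?thesis
  proof (cases j)
    case 0
    thus ?thesis using floor[of 0] assms(1)
      by (simp add: increment_def block_rate_def real_threshold_def abs_le_iff)
  next
    case (Suc i)
    have "real n * block_rate n x j = real_threshold n x j - real_threshold n x i"
      using Suc by (simp add: block_rate_def real_threshold_def algebra_simps)
    thus ?thesis using floor[of j] floor[of i] assms Suc
      by (simp add: increment_def of_nat_diff abs_le_iff)
  qed
qed

lemma gumbel_exponent_continuous:
  fixes x :: "nat \<Rightarrow> real"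
  shows "((\<lambda>\<epsilon>. exp (- (\<Sum>r\<in>I. exp (- (x r + s * (real r + 1) * \<epsilon>)) / fact r)))
    \<longlongrightarrow> exp (- (\<Sum>r\<in>I. exp (- x r) / fact r))) (at_right 0)"
proof -
  have "((\<lambda>\<epsilon>. exp (- (\<Sum>r\<in>I. exp (- (x r + s * (real r + 1) * \<epsilon>)) / fact r)))
    \<longlongrightarrow> exp (- (\<Sum>r\<in>I. exp (- (x r + s * (real r + 1) * 0)) / fact r))) (at_right 0)"
    by (intro tendsto_intros) auto
  thus ?thesis by simp
qed

context coupon_collector
begin

text \<open>
  De-Poissonization.  Shifting \<open>x r\<close> by \<open>(r + 1) \<epsilon>\<close> changes the mean of every block length by the
  same amount \<open>\<epsilon> n\<close>.  For large \<open>n\<close> half of it exceeds the rounding error of the deadlines, and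
  the other half remains as room for the Poisson fluctuations, whose variance is of smaller order
  than \<open>n\<^sup>2\<close>.  Letting \<open>\<epsilon>\<close> tend to \<open>0\<close> closes the gap by continuity of the limit.
\<close>

lemma prob_collected_tendsto:
  assumes "finite I"
  shows "(\<lambda>n. measure (M n) (collected n I (threshold n x)))
    \<longlonglongrightarrow> exp (- (\<Sum>r\<in>I. exp (- x r) / fact r))"
proof -
  obtain m where I: "I \<subseteq> {..m}"
    using assms finite_nat_iff_bounded_le by auto
  define L where "L y = exp (- (\<Sum>r\<in>I. exp (- y r) / fact r :: real))" for y :: "nat \<Rightarrow> real"
  define a where "a n = measure (M n) (collected n I (threshold n x))" for n
  define q where "q y n = measure_pmf.prob (Pi_pmf {..m} 0 (\<lambda>j. poisson_pmf (block_rate n y j)))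
      {c. \<forall>r\<in>I. r < (\<Sum>j\<le>r. c j)} ^ n" for y n
  define err where "err y \<delta> n = (\<Sum>j\<le>m. block_rate n y j / real n) / \<delta>\<^sup>2" for y \<delta> n
  have q: "q y \<longlonglongrightarrow> L y" for y
    unfolding q_def[abs_def] L_def by (rule poissonized_limit[OF I])
  have err: "(\<lambda>n. err y \<delta> n) \<longlonglongrightarrow> 0" if "\<delta> > 0" for y \<delta>
  proof -
    have "(\<lambda>n. err y \<delta> n) \<longlonglongrightarrow> (\<Sum>j\<le>m. 0) / \<delta>\<^sup>2"
      unfolding err_def using that by (intro tendsto_intros block_rate_sublinear) auto
    thus ?thesis by simp
  qed
  define shift where "shift s \<epsilon> r = x r + s * (real r + 1) * \<epsilon>" for s \<epsilon> :: real and r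
  have shift_rate: "block_rate n (shift s \<epsilon>) j = block_rate n x j + s * \<epsilon>" for n s \<epsilon> j
    by (cases j) (auto simp: block_rate_def shift_def algebra_simps)
  have incr: "\<forall>\<^sub>F n in sequentially. n \<ge> 1 \<and> 1 \<le> real n * (\<epsilon> / 2) \<and>
      collected n I (\<lambda>r. \<Sum>j\<le>r. increment (threshold n x) j) = collected n I (threshold n x) \<and>
      (\<forall>j\<le>m. \<bar>real (increment (threshold n x) j) - real n * block_rate n x j\<bar> \<le> 1)"
    if "\<epsilon> > 0" for \<epsilon> :: real
  proof -
    have "\<forall>\<^sub>F n in sequentially. 1 \<le> real n * (\<epsilon> / 2)"
      using that by real_asymp
    with eventually_threshold[of m x] eventually_ge_at_top[of 1] show ?thesis
    proof eventually_elim
      case (elim n)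
      have "(\<Sum>j\<le>r. increment (threshold n x) j) = threshold n x r" if "r \<in> I" for r
        using elim(1) that I by (intro sum_increment[of m]) auto
      hence "collected n I (\<lambda>r. \<Sum>j\<le>r. increment (threshold n x) j) = collected n I (threshold n x)"
        unfolding collected_def by (intro Collect_cong conj_cong ball_cong refl) auto
      moreover have "\<bar>real (increment (threshold n x) j) - real n * block_rate n x j\<bar> \<le> 1" if "j \<le> m" for j
      proof (rule increment_threshold)
        show "threshold n x (j - 1) \<le> threshold n x j" if "j > 0"
          using elim(1)[rule_format, of "j - 1"] that \<open>j \<le> m\<close> by simp
      qed (use elim(1) that in auto)
      ultimately show ?case using elim by blast
    qed
  qed
  have upper: "\<forall>\<^sub>F n in sequentially. a n \<le> q (shift 1 \<epsilon>) n + err (shift 1 \<epsilon>) (\<epsilon> / 2) n"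
    if "\<epsilon> > 0" for \<epsilon>
    using incr[OF that] eventually_block_rate_pos[of m "shift 1 \<epsilon>"]
  proof eventually_elim
    case (elim n)
    have "measure (M n) (collected n I (\<lambda>r. \<Sum>j\<le>r. increment (threshold n x) j))
        \<le> q (shift 1 \<epsilon>) n + err (shift 1 \<epsilon>) (\<epsilon> / 2) n"
      unfolding q_def err_def
    proof (rule poissonized_sandwich(1))
      fix j assume "j \<le> m"
      hence "\<bar>real (increment (threshold n x) j) - real n * block_rate n x j\<bar> \<le> real n * (\<epsilon> / 2)"
        using elim(1) order_trans by blast
      hence "real (increment (threshold n x) j) - real n * block_rate n x j \<le> real n * (\<epsilon> / 2)"
        by (rule abs_le_D1)
      thus "real (increment (threshold n x) j) \<le> real n * block_rate n (shift 1 \<epsilon>) j - real n * (\<epsilon> / 2)"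
        using arg_cong[OF shift_rate[of n 1 \<epsilon> j], of "\<lambda>u. real n * u"]
        by (simp add: distrib_left mult.commute)
    qed (use elim that I in auto)
    thus ?case using elim(1) by (simp add: a_def)
  qed
  have lower: "\<forall>\<^sub>F n in sequentially. q (shift (-1) \<epsilon>) n - err (shift (-1) \<epsilon>) (\<epsilon> / 2) n \<le> a n"
    if "\<epsilon> > 0" for \<epsilon>
    using incr[OF that] eventually_block_rate_pos[of m "shift (-1) \<epsilon>"]
  proof eventually_elim
    case (elim n)
    have "q (shift (-1) \<epsilon>) n \<le> measure (M n) (collected n I (\<lambda>r. \<Sum>j\<le>r. increment (threshold n x) j))
        + err (shift (-1) \<epsilon>) (\<epsilon> / 2) n"
      unfolding q_def err_def
    proof (rule poissonized_sandwich(2))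
      fix j assume "j \<le> m"
      hence "\<bar>real (increment (threshold n x) j) - real n * block_rate n x j\<bar> \<le> real n * (\<epsilon> / 2)"
        using elim(1) order_trans by blast
      hence "- (real (increment (threshold n x) j) - real n * block_rate n x j) \<le> real n * (\<epsilon> / 2)"
        by (rule abs_le_D2)
      thus "real n * block_rate n (shift (-1) \<epsilon>) j + real n * (\<epsilon> / 2) \<le> real (increment (threshold n x) j)"
        using arg_cong[OF shift_rate[of n "-1" \<epsilon> j], of "\<lambda>u. real n * u"]
        by (simp add: right_diff_distrib mult.commute)
    qed (use elim that I in auto)
    thus ?case using elim(1) by (simp add: a_def)
  qed
  have cont: "((\<lambda>\<epsilon>. L (shift s \<epsilon>)) \<longlongrightarrow> L x) (at_right 0)" for s
    unfolding L_def shift_def by (rule gumbel_exponent_continuous)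
  have "a \<longlonglongrightarrow> L x"
  proof (rule order_tendstoI)
    fix b assume "b < L x"
    with cont[of "-1"] have "\<forall>\<^sub>F \<epsilon> in at_right 0. b < L (shift (-1) \<epsilon>)"
      by (rule order_tendstoD)
    with eventually_at_right_less[of 0] obtain \<epsilon> where \<epsilon>: "\<epsilon> > 0" "b < L (shift (-1) \<epsilon>)"
      using eventually_happens'[OF trivial_limit_at_right_real eventually_conj] by blast
    have "(\<lambda>n. q (shift (-1) \<epsilon>) n - err (shift (-1) \<epsilon>) (\<epsilon> / 2) n) \<longlonglongrightarrow> L (shift (-1) \<epsilon>) - 0"
      using \<epsilon>(1) by (intro tendsto_diff q err) auto
    hence "\<forall>\<^sub>F n in sequentially. b < q (shift (-1) \<epsilon>) n - err (shift (-1) \<epsilon>) (\<epsilon> / 2) n"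
      using \<epsilon>(2) by (intro order_tendstoD(1)[where y = "L (shift (-1) \<epsilon>)"]) auto
    with lower[OF \<epsilon>(1)] show "\<forall>\<^sub>F n in sequentially. b < a n"
      by eventually_elim auto
  next
    fix b assume "L x < b"
    with cont[of 1] have "\<forall>\<^sub>F \<epsilon> in at_right 0. L (shift 1 \<epsilon>) < b"
      by (rule order_tendstoD)
    with eventually_at_right_less[of 0] obtain \<epsilon> where \<epsilon>: "\<epsilon> > 0" "L (shift 1 \<epsilon>) < b"
      using eventually_happens'[OF trivial_limit_at_right_real eventually_conj] by blast
    have "(\<lambda>n. q (shift 1 \<epsilon>) n + err (shift 1 \<epsilon>) (\<epsilon> / 2) n) \<longlonglongrightarrow> L (shift 1 \<epsilon>) + 0"
      using \<epsilon>(1) by (intro tendsto_add q err) auto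
    hence "\<forall>\<^sub>F n in sequentially. q (shift 1 \<epsilon>) n + err (shift 1 \<epsilon>) (\<epsilon> / 2) n < b"
      using \<epsilon>(2) by (intro order_tendstoD(2)[where y = "L (shift 1 \<epsilon>)"]) auto
    with upper[OF \<epsilon>(1)] show "\<forall>\<^sub>F n in sequentially. a n < b"
      by eventually_elim auto
  qed
  thus ?thesis by (simp add: a_def[abs_def] L_def)
qed

section \<open>Convergence of the completion times\<close>

definition normalized_time :: "nat \<Rightarrow> 'a \<Rightarrow> nat \<Rightarrow> real" where
  "normalized_time n \<omega> r = real (completion_time n (\<lambda>k. X n k \<omega>) r) / real n - ln (real n) - real r * ln (ln (real n))"

lemma completion_time_le_iff:
  "n \<ge> 1 \<Longrightarrow> completion_time n c r \<le> t \<longleftrightarrow> (\<forall>i\<in>{1..n}. arrival_time c i r \<le> t)"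
  unfolding completion_time_def by (subst Max_le_iff) auto

lemma measurable_arrival_time:
  assumes "n \<ge> 1"
  shows "(\<lambda>\<omega>. arrival_time (\<lambda>k. X n k \<omega>) i r) \<in> measurable (M n) (count_space UNIV)"
  unfolding arrival_time_def type_counts_def[symmetric]
proof (rule measurable_Least)
  fix k
  have "(\<lambda>v. v = r + 1) \<in> measurable (count_space (UNIV :: nat set)) (count_space UNIV)" by simp
  from measurable_compose[OF measurable_type_counts[OF assms] this]
  show "(\<lambda>\<omega>. type_counts {1..k} (\<lambda>k. X n k \<omega>) i = r + 1) \<in> measurable (M n) (count_space UNIV)" .
qed

lemma measurable_normalized_time:
  assumes "n \<ge> 1"
  shows "normalized_time n \<in> borel_measurable (M n)"
proof (rule measurable_coordinatewise_then_product)
  fix r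
  have "(\<lambda>\<omega>. completion_time n (\<lambda>k. X n k \<omega>) r) \<in> borel_measurable (M n)"
    unfolding completion_time_def
    by (intro borel_measurable_Max measurable_compose[OF measurable_arrival_time[OF assms]]) auto
  hence "(\<lambda>\<omega>. real (completion_time n (\<lambda>k. X n k \<omega>) r)) \<in> borel_measurable (M n)"
    by (rule measurable_compose) (intro borel_measurable_continuous_onI continuous_on_of_nat continuous_on_id)
  thus "(\<lambda>\<omega>. normalized_time n \<omega> r) \<in> borel_measurable (M n)"
    unfolding normalized_time_def by (intro borel_measurable_diff borel_measurable_divide) auto
qed

lemma normalized_time_le_iff:
  assumes "n \<ge> 1" "0 \<le> real_threshold n x r"
  shows "normalized_time n \<omega> r \<le> x r \<longleftrightarrow> (\<forall>i\<in>{1..n}. arrival_time (\<lambda>k. X n k \<omega>) i r \<le> threshold n x r)"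
proof -
  have "normalized_time n \<omega> r \<le> x r \<longleftrightarrow> real (completion_time n (\<lambda>k. X n k \<omega>) r) \<le> real_threshold n x r"
    using assms(1) by (simp add: normalized_time_def real_threshold_def field_simps)
  also have "\<dots> \<longleftrightarrow> completion_time n (\<lambda>k. X n k \<omega>) r \<le> threshold n x r"
    using assms(2) by (simp add: threshold_def le_nat_iff le_floor_iff)
  finally show ?thesis by (simp add: completion_time_le_iff[OF assms(1)])
qed

text \<open>
  Completion times and counts describe the same event unless some coupon never arrives.  In that
  case no collection is ever complete, so for any \<open>y\<close> the exceptional probability is at most that
  of an incomplete collection at the deadlines of \<open>y\<close>; constant \<open>y\<close> tending to infinity makes its
  limit arbitrarily small.
\<close>

lemma normalized_time_orthant_tendsto:
  assumes I: "finite I"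
  shows "(\<lambda>n. \<P>(\<omega> in M n. \<forall>r\<in>I. normalized_time n \<omega> r \<le> x r)) \<longlonglongrightarrow> exp (- (\<Sum>r\<in>I. exp (- x r) / fact r))"
proof -
  obtain m where m: "I \<subseteq> {..m}"
    using assms finite_nat_iff_bounded_le by auto
  define L where "L y = exp (- (\<Sum>r\<in>I. exp (- y r) / fact r :: real))" for y :: "nat \<Rightarrow> real"
  define a where "a y n = measure (M n) (collected n I (threshold n y))" for y n
  have a: "a y \<longlonglongrightarrow> L y" for y
    unfolding a_def[abs_def] L_def by (rule prob_collected_tendsto[OF I])
  define e where "e n = \<P>(\<omega> in M n. \<forall>r\<in>I. normalized_time n \<omega> r \<le> x r)" for n
  have bounds: "\<forall>\<^sub>F n in sequentially. a x n \<le> e n \<and> e n \<le> a x n + (1 - a y n)" for y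
    using eventually_threshold[of m x] eventually_ge_at_top[of 1]
  proof eventually_elim
    case (elim n)
    interpret prob_space "M n" using elim(2) by (rule coupon_space)
    define E where "E = {\<omega> \<in> space (M n). \<forall>r\<in>I. normalized_time n \<omega> r \<le> x r}"
    have E: "E = {\<omega> \<in> space (M n). \<forall>r\<in>I. \<forall>i\<in>{1..n}. arrival_time (\<lambda>k. X n k \<omega>) i r \<le> threshold n x r}"
      unfolding E_def using elim m by (intro Collect_cong conj_cong ball_cong refl normalized_time_le_iff) auto
    have "E = {\<omega> \<in> space (M n). \<forall>r\<in>I. (\<lambda>\<omega>. normalized_time n \<omega> r) \<omega> \<in> {..x r}}" by (auto simp: E_def)
    also have "\<dots> \<in> events"
    proof (intro sets.sets_Collect_finite_All I)
      fix r
      have "(\<lambda>\<omega>. normalized_time n \<omega> r) \<in> borel_measurable (M n)"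
        using measurable_normalized_time[OF elim(2)] by (rule measurable_product_then_coordinatewise)
      from measurable_sets[OF this, of "{..x r}"]
      show "{\<omega> \<in> space (M n). normalized_time n \<omega> r \<in> {..x r}} \<in> events"
        by (simp add: vimage_def Int_def conj_commute)
    qed
    finally have E_sets: "E \<in> events" .
    note C = collected_sets[OF elim(2) I]
    have "collected n I (threshold n x) \<subseteq> E"
      unfolding E collected_def using arrival_time_le by blast
    hence 1: "a x n \<le> prob E"
      unfolding a_def using E_sets by (rule finite_measure_mono)
    have "E \<subseteq> collected n I (threshold n x) \<union> (space (M n) - collected n I (threshold n y))"
    proof
      fix \<omega> assume \<omega>: "\<omega> \<in> E"
      show "\<omega> \<in> collected n I (threshold n x) \<union> (space (M n) - collected n I (threshold n y))"
      proof (cases "\<omega> \<in> collected n I (threshold n y)")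
        case True
        have "r < type_counts {1..threshold n x r} (\<lambda>k. X n k \<omega>) i" if ri: "r \<in> I" "i \<in> {1..n}" for r i
        proof (rule less_type_counts_if_arrival_time_le)
          show "arrival_time (\<lambda>k. X n k \<omega>) i r \<le> threshold n x r"
            using \<omega> ri unfolding E by blast
          show "r < type_counts {1..threshold n y r} (\<lambda>k. X n k \<omega>) i"
            using True ri unfolding collected_def by blast
        qed
        thus ?thesis using \<omega> unfolding E collected_def by blast
      next
        case False
        thus ?thesis using \<omega> unfolding E by blast
      qed
    qed
    hence "prob E \<le> prob (collected n I (threshold n x) \<union> (space (M n) - collected n I (threshold n y)))"
      using C by (intro finite_measure_mono) auto
    also have "\<dots> \<le> a x n + prob (space (M n) - collected n I (threshold n y))"
      unfolding a_def using C by (intro measure_Un_le) auto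
    also have "\<dots> = a x n + (1 - a y n)"
      unfolding a_def using C by (simp add: prob_compl)
    finally show ?case using 1 by (simp add: e_def E_def)
  qed
  have "e \<longlonglongrightarrow> L x"
  proof (rule order_tendstoI)
    fix b assume "b < L x"
    from order_tendstoD(1)[OF a this] bounds[of x] show "\<forall>\<^sub>F n in sequentially. b < e n"
      by eventually_elim auto
  next
    fix b assume b: "L x < b"
    \<comment> \<open>For a constant shift \<open>K\<close> of the deadlines the limit tends to \<open>1\<close> as \<open>K\<close> grows.\<close>
    have "((\<lambda>K. L (\<lambda>_. K)) \<longlongrightarrow> exp (- (\<Sum>r\<in>I. 0 / fact r))) at_top"
      unfolding L_def
      by (intro tendsto_intros filterlim_compose[OF exp_at_bot] filterlim_uminus_at_bot_at_top) auto
    hence "((\<lambda>K. L x + (1 - L (\<lambda>_. K))) \<longlongrightarrow> L x + (1 - 1)) at_top"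
      by (intro tendsto_intros) simp
    hence "\<forall>\<^sub>F K in at_top. L x + (1 - L (\<lambda>_. K)) < b"
      using b by (intro order_tendstoD(2)) auto
    then obtain K where K: "L x + (1 - L (\<lambda>_. K)) < b"
      using eventually_happens'[OF trivial_limit_at_top_linorder] by blast
    have "(\<lambda>n. a x n + (1 - a (\<lambda>_. K) n)) \<longlonglongrightarrow> L x + (1 - L (\<lambda>_. K))"
      by (intro tendsto_intros a)
    from order_tendstoD(2)[OF this K] bounds[of "\<lambda>_. K"] show "\<forall>\<^sub>F n in sequentially. e n < b"
      by eventually_elim auto
  qed
  thus ?thesis by (simp add: e_def[abs_def] L_def)
qed

end

text \<open>
  The Gumbel distribution function is continuous, so \<open>B r < x\<close> and \<open>B r \<le> x\<close> have the same
  probability.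
\<close>

lemma (in prob_space) gumbel_orthant:
  fixes B :: "nat \<Rightarrow> 'a \<Rightarrow> real"
  assumes indep: "indep_vars (\<lambda>_. borel) B UNIV"
    and distr: "\<And>r x. \<P>(\<omega> in M. B r \<omega> < x) = exp (- (exp (- x) / fact r))"
    and I: "finite I"
  shows "\<P>(\<omega> in M. \<forall>r\<in>I. B r \<omega> \<le> x r) = exp (- (\<Sum>r\<in>I. exp (- x r) / fact r))"
proof -
  have [measurable]: "B r \<in> borel_measurable M" for r
    using indep by (auto simp: indep_vars_def)
  have le: "\<P>(\<omega> in M. B r \<omega> \<le> y) = exp (- (exp (- y) / fact r))" for r y
  proof (rule antisym)
    have "((\<lambda>z. exp (- (exp (- z) / fact r))) \<longlongrightarrow> exp (- (exp (- y) / fact r))) (at_right y)"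
      by (intro tendsto_intros) auto
    moreover have "\<forall>\<^sub>F z in at_right y. \<P>(\<omega> in M. B r \<omega> \<le> y) \<le> exp (- (exp (- z) / fact r))"
      using eventually_at_right_less[of y]
    proof eventually_elim
      case (elim z)
      have "\<P>(\<omega> in M. B r \<omega> \<le> y) \<le> \<P>(\<omega> in M. B r \<omega> < z)"
        using elim by (intro finite_measure_mono) auto
      thus ?case by (simp add: distr)
    qed
    ultimately show "\<P>(\<omega> in M. B r \<omega> \<le> y) \<le> exp (- (exp (- y) / fact r))"
      by (rule tendsto_lowerbound) simp
    have "\<P>(\<omega> in M. B r \<omega> < y) \<le> \<P>(\<omega> in M. B r \<omega> \<le> y)"
      by (intro finite_measure_mono) auto
    thus "exp (- (exp (- y) / fact r)) \<le> \<P>(\<omega> in M. B r \<omega> \<le> y)"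
      by (simp add: distr)
  qed
  show ?thesis
  proof (cases "I = {}")
    case True
    thus ?thesis by (simp add: prob_space)
  next
    case False
    have "{\<omega> \<in> space M. \<forall>r\<in>I. B r \<omega> \<le> x r} = (\<Inter>r\<in>I. B r -` {..x r} \<inter> space M)"
      using False by auto
    also have "prob \<dots> = (\<Prod>r\<in>I. prob (B r -` {..x r} \<inter> space M))"
      using indep False I by (rule indep_varsD) auto
    also have "\<dots> = (\<Prod>r\<in>I. \<P>(\<omega> in M. B r \<omega> \<le> x r))"
      by (intro prod.cong refl arg_cong[where f = prob]) auto
    finally show ?thesis
      using I by (simp add: le exp_sum sum_negf[symmetric])
  qed
qed

theorem theorem2p3:
  fixes M :: "nat \<Rightarrow> 'a measure"
    and X :: "nat \<Rightarrow> nat \<Rightarrow> 'a \<Rightarrow> nat"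
    and N :: "'b measure"
    and B :: "nat \<Rightarrow> 'b \<Rightarrow> real"
  assumes coupon_space: "\<And>n. n \<ge> 1 \<Longrightarrow> prob_space (M n)"
    and coupon_indep: "\<And>n. n \<ge> 1 \<Longrightarrow>
          prob_space.indep_vars (M n) (\<lambda>_. count_space UNIV) (X n) {1..}"
    and coupon_uniform: "\<And>n k. n \<ge> 1 \<Longrightarrow> k \<ge> 1 \<Longrightarrow>
          distr (M n) (count_space UNIV) (X n k) = measure_pmf (pmf_of_set {1..n})"
    and gumbel_space: "prob_space N"
    and gumbel_indep: "prob_space.indep_vars N (\<lambda>_. borel) B UNIV"
    and gumbel_distr: "\<And>r x. \<P>(\<omega> in N. B r \<omega> < x) = exp (- (exp (- x) / fact r))"
  shows "converges_in_distribution M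
           (\<lambda>n \<omega> r. real (completion_time n (\<lambda>k. X n k \<omega>) r) / real n
                     - ln (real n) - real r * ln (ln (real n)))
           N (\<lambda>\<omega> r. B r \<omega>)"
proof -
  interpret coupon_collector M X
    by (rule coupon_collector.intro) (fact coupon_space coupon_indep coupon_uniform)+
  have ev: "\<forall>\<^sub>F n in sequentially. (1 :: nat) \<le> n" by (rule eventually_ge_at_top)
  have "converges_in_distribution M normalized_time N (\<lambda>\<omega> r. B r \<omega>)"
  proof (rule converges_in_distribution_if_orthants)
    show "\<forall>\<^sub>F n in sequentially. prob_space (M n)"
      using ev by eventually_elim (rule coupon_space)
    show "\<forall>\<^sub>F n in sequentially. normalized_time n \<in> borel_measurable (M n)"
      using ev by eventually_elim (rule measurable_normalized_time)
    show "(\<lambda>\<omega> r. B r \<omega>) \<in> borel_measurable N"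
      using gumbel_indep
      by (intro measurable_coordinatewise_then_product)
         (auto simp: prob_space.indep_vars_def[OF gumbel_space])
    show "(\<lambda>n. \<P>(\<omega> in M n. \<forall>r\<in>I. normalized_time n \<omega> r \<le> x r)) \<longlonglongrightarrow> \<P>(\<omega> in N. \<forall>r\<in>I. B r \<omega> \<le> x r)"
      if "finite I" for I x
      unfolding prob_space.gumbel_orthant[OF gumbel_space gumbel_indep gumbel_distr that]
      by (rule normalized_time_orthant_tendsto[OF that])
  qed (rule gumbel_space)
  thus ?thesis unfolding normalized_time_def[abs_def] .
qed

end
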